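(* Let $\mathcal A$ be a category with finite products and finite coproducts, equipped with a model structure $(\mathsf{Cofib},\mathsf{Fib},\mathsf{Weq})$, and let $\gamma:\mathcal A\to\operatorname{Ho}(\mathcal A)=\mathcal A[\mathsf{Weq}^{-1}]$ be the localization. Fix a (small) set $I$. (1) If $\mathcal A$ has $I$-indexed coproducts and $\mathsf{Weq}$ is closed under these coproducts, then $\operatorname{Ho}(\mathcal A)$ has $I$-indexed coproducts and $\gamma$ preserves them. (2) If $\mathcal A$ has $I$-indexed products and $\mathsf{Weq}$ is closed under these products, then $\operatorname{Ho}(\mathcal A)$ has $I$-indexed products and $\gamma$ preserves them. In particular, if $\mathcal A$ has all (small) coproducts (respectively, products) and $\mathsf{Weq}$ is closed under them, then $\gamma$ preserves all coproducts (respectively, products).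
   Context: Size issues are ignored (or handled by universes). The Gabriel--Zisman localization $\gamma:\mathcal A\to\mathcal A[\mathsf{Weq}^{-1}]$ sends $\mathsf{Weq}$ to isomorphisms, and every functor out of $\mathcal A$ sending $\mathsf{Weq}$ to isomorphisms factors uniquely (on the nose) through it. A model structure on $\mathcal A$ consists of three classes of morphisms $(\mathsf{Cofib},\mathsf{Fib},\mathsf{Weq})$, each containing all identity morphisms and closed under composition, such that, with $\mathsf{TCofib}=\mathsf{Cofib}\cap\mathsf{Weq}$ and $\mathsf{TFib}=\mathsf{Fib}\cap\mathsf{Weq}$: (CM1) for every composable pair, if two of $f,g,g\circ f$ are in $\mathsf{Weq}$, so is the third; (CM2) each of the three classes is closed under retracts in the arrow category; (CM3) for every commutative square $p\circ a=b\circ i$ with $i:X\to Y$, $p:E\to B$, $a:X\to E$, $b:Y\to B$, if either $i\in\mathsf{Cofib}$ and $p\in\mathsf{TFib}$, or $i\in\mathsf{TCofib}$ and $p\in\mathsf{Fib}$, there is $h:Y\to E$ with $h\circ i=a$ and $p\circ h=b$; (CM4) every morphism $f$ factors as $f=p\circ i$ with $i\in\mathsf{Cofib}$, $p\in\mathsf{TFib}$, and also as $f=p'\circ i'$ with $i'\in\mathsf{TCofib}$, $p'\in\mathsf{Fib}$. The factorizations are not required to be functorial, and no limits or colimits beyond finite products and finite coproducts are assumed. $\mathsf{Weq}$ is closed under $I$-indexed coproducts (resp. products) if for every family $(s_i:X_i\to Y_i)_{i\in I}$ of morphisms in $\mathsf{Weq}$, the induced morphism $\coprod_{i}s_i:\coprod_i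 X_i\to\coprod_i Y_i$ (resp. $\prod_i s_i:\prod_i X_i\to\prod_i Y_i$) is in $\mathsf{Weq}$. *)

theory Defs
  imports Main
begin

section \<open>Categories and functors\<close>

record ('o, 'm) cat =
  Obj :: "'o set"
  Arr :: "'m set"
  Dom :: "'m \<Rightarrow> 'o"
  Cod :: "'m \<Rightarrow> 'o"
  Ide :: "'o \<Rightarrow> 'm"
  Comp :: "'m \<Rightarrow> 'm \<Rightarrow> 'm" (infixr "\<cdot>\<index>" 70)

definition hom :: "('o, 'm) cat \<Rightarrow> 'o \<Rightarrow> 'o \<Rightarrow> 'm set" where
  "hom C x y = {f \<in> Arr C. Dom C f = x \<and> Cod C f = y}"

locale category =
  fixes C :: "('o, 'm) cat" (structure)
  assumes dom_obj: "f \<in> Arr C \<Longrightarrow> Dom C f \<in> Obj C"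
    and cod_obj: "f \<in> Arr C \<Longrightarrow> Cod C f \<in> Obj C"
    and ide_hom: "x \<in> Obj C \<Longrightarrow> Ide C x \<in> hom C x x"
    and comp_hom: "\<lbrakk>f \<in> hom C x y; g \<in> hom C y z\<rbrakk> \<Longrightarrow> g \<cdot> f \<in> hom C x z"
    and ide_right: "f \<in> hom C x y \<Longrightarrow> f \<cdot> Ide C x = f"
    and ide_left: "f \<in> hom C x y \<Longrightarrow> Ide C y \<cdot> f = f"
    and comp_assoc: "\<lbrakk>f \<in> hom C x y; g \<in> hom C y z; h \<in> hom C z w\<rbrakk>
      \<Longrightarrow> (h \<cdot> g) \<cdot> f = h \<cdot> (g \<cdot> f)"

definition inverse_arrows :: "('o, 'm) cat \<Rightarrow> 'm \<Rightarrow> 'm \<Rightarrow> bool" where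
  "inverse_arrows C f g \<longleftrightarrow>
     f \<in> Arr C \<and> g \<in> hom C (Cod C f) (Dom C f) \<and>
     Comp C g f = Ide C (Dom C f) \<and> Comp C f g = Ide C (Cod C f)"

definition is_iso :: "('o, 'm) cat \<Rightarrow> 'm \<Rightarrow> bool" where
  "is_iso C f \<longleftrightarrow> (\<exists>g. inverse_arrows C f g)"

record ('o, 'm, 'p, 'n) funct =
  omap :: "'o \<Rightarrow> 'p"
  amap :: "'m \<Rightarrow> 'n"

locale cat_functor = A: category A + B: category B
  for A :: "('o, 'm) cat" and B :: "('p, 'n) cat" and F :: "('o, 'm, 'p, 'n) funct" +
  assumes omap_obj: "x \<in> Obj A \<Longrightarrow> omap F x \<in> Obj B"
    and amap_hom: "f \<in> hom A x y \<Longrightarrow> amap F f \<in> hom B (omap F x) (omap F y)"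
    and amap_ide: "x \<in> Obj A \<Longrightarrow> amap F (Ide A x) = Ide B (omap F x)"
    and amap_comp: "\<lbrakk>f \<in> hom A x y; g \<in> hom A y z\<rbrakk>
      \<Longrightarrow> amap F (Comp A g f) = Comp B (amap F g) (amap F f)"


section \<open>Products and coproducts\<close>

definition is_coproduct ::
    "('o, 'm) cat \<Rightarrow> 'i set \<Rightarrow> ('i \<Rightarrow> 'o) \<Rightarrow> 'o \<Rightarrow> ('i \<Rightarrow> 'm) \<Rightarrow> bool" where
  "is_coproduct C I X c \<iota> \<longleftrightarrow>
     c \<in> Obj C \<and> (\<forall>i\<in>I. \<iota> i \<in> hom C (X i) c) \<and>
     (\<forall>d\<in>Obj C. \<forall>f. (\<forall>i\<in>I. f i \<in> hom C (X i) d) \<longrightarrow>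
        (\<exists>!h. h \<in> hom C c d \<and> (\<forall>i\<in>I. Comp C h (\<iota> i) = f i)))"

definition is_product ::
    "('o, 'm) cat \<Rightarrow> 'i set \<Rightarrow> ('i \<Rightarrow> 'o) \<Rightarrow> 'o \<Rightarrow> ('i \<Rightarrow> 'm) \<Rightarrow> bool" where
  "is_product C I X c \<pi> \<longleftrightarrow>
     c \<in> Obj C \<and> (\<forall>i\<in>I. \<pi> i \<in> hom C c (X i)) \<and>
     (\<forall>d\<in>Obj C. \<forall>f. (\<forall>i\<in>I. f i \<in> hom C d (X i)) \<longrightarrow>
        (\<exists>!h. h \<in> hom C d c \<and> (\<forall>i\<in>I. Comp C (\<pi> i) h = f i)))"

definition has_coproducts :: "('o, 'm) cat \<Rightarrow> 'i set \<Rightarrow> bool" where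
  "has_coproducts C I \<longleftrightarrow>
     (\<forall>X. (\<forall>i\<in>I. X i \<in> Obj C) \<longrightarrow> (\<exists>c \<iota>. is_coproduct C I X c \<iota>))"

definition has_products :: "('o, 'm) cat \<Rightarrow> 'i set \<Rightarrow> bool" where
  "has_products C I \<longleftrightarrow>
     (\<forall>X. (\<forall>i\<in>I. X i \<in> Obj C) \<longrightarrow> (\<exists>c \<pi>. is_product C I X c \<pi>))"

definition has_finite_coproducts :: "('o, 'm) cat \<Rightarrow> bool" where
  "has_finite_coproducts C \<longleftrightarrow> (\<forall>I :: nat set. finite I \<longrightarrow> has_coproducts C I)"

definition has_finite_products :: "('o, 'm) cat \<Rightarrow> bool" where
  "has_finite_products C \<longleftrightarrow> (\<forall>I :: nat set. finite I \<longrightarrow> has_products C I)"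

definition preserves_coproducts ::
    "('o, 'm) cat \<Rightarrow> ('p, 'n) cat \<Rightarrow> ('o, 'm, 'p, 'n) funct \<Rightarrow> 'i set \<Rightarrow> bool" where
  "preserves_coproducts A B F I \<longleftrightarrow>
     (\<forall>X c \<iota>. (\<forall>i\<in>I. X i \<in> Obj A) \<and> is_coproduct A I X c \<iota> \<longrightarrow>
        is_coproduct B I (\<lambda>i. omap F (X i)) (omap F c) (\<lambda>i. amap F (\<iota> i)))"

definition preserves_products ::
    "('o, 'm) cat \<Rightarrow> ('p, 'n) cat \<Rightarrow> ('o, 'm, 'p, 'n) funct \<Rightarrow> 'i set \<Rightarrow> bool" where
  "preserves_products A B F I \<longleftrightarrow>
     (\<forall>X c \<pi>. (\<forall>i\<in>I. X i \<in> Obj A) \<and> is_product A I X c \<pi> \<longrightarrow>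
        is_product B I (\<lambda>i. omap F (X i)) (omap F c) (\<lambda>i. amap F (\<pi> i)))"

text \<open>
  In the next two definitions \<open>t\<close> is the induced morphism between (co)products.  All choices of
  (co)product are considered; they differ by isomorphisms.
\<close>

definition closed_under_coproducts :: "('o, 'm) cat \<Rightarrow> 'i set \<Rightarrow> 'm set \<Rightarrow> bool" where
  "closed_under_coproducts C I W \<longleftrightarrow>
     (\<forall>s c \<iota> d \<kappa> t.
        (\<forall>i\<in>I. s i \<in> W) \<and>
        is_coproduct C I (\<lambda>i. Dom C (s i)) c \<iota> \<and>
        is_coproduct C I (\<lambda>i. Cod C (s i)) d \<kappa> \<and>
        t \<in> hom C c d \<and> (\<forall>i\<in>I. Comp C t (\<iota> i) = Comp C (\<kappa> i) (s i))
        \<longrightarrow> t \<in> W)"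

definition closed_under_products :: "('o, 'm) cat \<Rightarrow> 'i set \<Rightarrow> 'm set \<Rightarrow> bool" where
  "closed_under_products C I W \<longleftrightarrow>
     (\<forall>s c \<pi> d \<rho> t.
        (\<forall>i\<in>I. s i \<in> W) \<and>
        is_product C I (\<lambda>i. Dom C (s i)) c \<pi> \<and>
        is_product C I (\<lambda>i. Cod C (s i)) d \<rho> \<and>
        t \<in> hom C c d \<and> (\<forall>i\<in>I. Comp C (\<rho> i) t = Comp C (s i) (\<pi> i))
        \<longrightarrow> t \<in> W)"


section \<open>Model structures\<close>

definition wide_subcategory :: "('o, 'm) cat \<Rightarrow> 'm set \<Rightarrow> bool" where
  "wide_subcategory C S \<longleftrightarrow>
     S \<subseteq> Arr C \<and> (\<forall>x\<in>Obj C. Ide C x \<in> S) \<and>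
     (\<forall>f\<in>S. \<forall>g\<in>S. Cod C f = Dom C g \<longrightarrow> Comp C g f \<in> S)"

definition two_of_three :: "('o, 'm) cat \<Rightarrow> 'm set \<Rightarrow> bool" where
  "two_of_three C S \<longleftrightarrow>
     (\<forall>f\<in>Arr C. \<forall>g\<in>Arr C. Cod C f = Dom C g \<longrightarrow>
        (f \<in> S \<and> g \<in> S \<longrightarrow> Comp C g f \<in> S) \<and>
        (f \<in> S \<and> Comp C g f \<in> S \<longrightarrow> g \<in> S) \<and>
        (g \<in> S \<and> Comp C g f \<in> S \<longrightarrow> f \<in> S))"

definition is_retract :: "('o, 'm) cat \<Rightarrow> 'm \<Rightarrow> 'm \<Rightarrow> bool" where
  "is_retract C f g \<longleftrightarrow>
     f \<in> Arr C \<and> g \<in> Arr C \<and>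
     (\<exists>i\<in>hom C (Dom C f) (Dom C g). \<exists>r\<in>hom C (Dom C g) (Dom C f).
      \<exists>j\<in>hom C (Cod C f) (Cod C g). \<exists>q\<in>hom C (Cod C g) (Cod C f).
        Comp C g i = Comp C j f \<and> Comp C f r = Comp C q g \<and>
        Comp C r i = Ide C (Dom C f) \<and> Comp C q j = Ide C (Cod C f))"

definition closed_under_retracts :: "('o, 'm) cat \<Rightarrow> 'm set \<Rightarrow> bool" where
  "closed_under_retracts C S \<longleftrightarrow> (\<forall>f g. g \<in> S \<and> is_retract C f g \<longrightarrow> f \<in> S)"

definition has_lifting :: "('o, 'm) cat \<Rightarrow> 'm set \<Rightarrow> 'm set \<Rightarrow> bool" where
  "has_lifting C L R \<longleftrightarrow>
     (\<forall>i\<in>L. \<forall>p\<in>R. \<forall>a\<in>hom C (Dom C i) (Dom C p). \<forall>b\<in>hom C (Cod C i) (Cod C p).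
        Comp C p a = Comp C b i \<longrightarrow>
        (\<exists>h\<in>hom C (Cod C i) (Dom C p). Comp C h i = a \<and> Comp C p h = b))"

definition has_factorization :: "('o, 'm) cat \<Rightarrow> 'm set \<Rightarrow> 'm set \<Rightarrow> bool" where
  "has_factorization C L R \<longleftrightarrow>
     (\<forall>f\<in>Arr C. \<exists>i\<in>L. \<exists>p\<in>R. Cod C i = Dom C p \<and> f = Comp C p i)"

locale model_structure = category C
  for C :: "('o, 'm) cat" and Cofib Fib Weq :: "'m set" +
  assumes cofib_wide: "wide_subcategory C Cofib"
    and fib_wide: "wide_subcategory C Fib"
    and weq_wide: "wide_subcategory C Weq"
    and CM1: "two_of_three C Weq"
    and CM2_cofib: "closed_under_retracts C Cofib"
    and CM2_fib: "closed_under_retracts C Fib"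
    and CM2_weq: "closed_under_retracts C Weq"
    and CM3_cofib: "has_lifting C Cofib (Fib \<inter> Weq)"
    and CM3_fib: "has_lifting C (Cofib \<inter> Weq) Fib"
    and CM4_cofib: "has_factorization C Cofib (Fib \<inter> Weq)"
    and CM4_fib: "has_factorization C (Cofib \<inter> Weq) Fib"


section \<open>The Gabriel--Zisman localization\<close>

text \<open>
  \<open>GZ C W\<close> is the quotient of the free category on the arrows of \<open>C\<close> together with formal
  inverses of the arrows in \<open>W\<close>.  Paths are listed in the order in which they are traversed.
\<close>

datatype 'm step = Fwd 'm | Bwd 'm

fun path :: "('o, 'm) cat \<Rightarrow> 'm set \<Rightarrow> 'o \<Rightarrow> 'm step list \<Rightarrow> 'o \<Rightarrow> bool" where
  "path C W x [] y \<longleftrightarrow> x = y \<and> x \<in> Obj C"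
| "path C W x (Fwd f # p) y \<longleftrightarrow> f \<in> Arr C \<and> Dom C f = x \<and> path C W (Cod C f) p y"
| "path C W x (Bwd w # p) y \<longleftrightarrow> w \<in> W \<and> w \<in> Arr C \<and> Cod C w = x \<and> path C W (Dom C w) p y"

inductive gz_eq ::
    "('o, 'm) cat \<Rightarrow> 'm set \<Rightarrow> 'o \<Rightarrow> 'o \<Rightarrow> 'm step list \<Rightarrow> 'm step list \<Rightarrow> bool"
  for C W where
  gz_refl: "path C W x p y \<Longrightarrow> gz_eq C W x y p p"
| gz_sym: "gz_eq C W x y p q \<Longrightarrow> gz_eq C W x y q p"
| gz_trans: "\<lbrakk>gz_eq C W x y p q; gz_eq C W x y q r\<rbrakk> \<Longrightarrow> gz_eq C W x y p r"
| gz_append: "\<lbrakk>gz_eq C W x y p q; gz_eq C W y z p' q'\<rbrakk> \<Longrightarrow> gz_eq C W x z (p @ p') (q @ q')"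
| gz_ide: "x \<in> Obj C \<Longrightarrow> gz_eq C W x x [Fwd (Ide C x)] []"
| gz_comp: "\<lbrakk>f \<in> hom C x y; g \<in> hom C y z\<rbrakk> \<Longrightarrow> gz_eq C W x z [Fwd f, Fwd g] [Fwd (Comp C g f)]"
| gz_inv_right: "\<lbrakk>w \<in> W; w \<in> hom C x y\<rbrakk> \<Longrightarrow> gz_eq C W x x [Fwd w, Bwd w] []"
| gz_inv_left: "\<lbrakk>w \<in> W; w \<in> hom C x y\<rbrakk> \<Longrightarrow> gz_eq C W y y [Bwd w, Fwd w] []"

type_synonym ('o, 'm) gz_arr = "'o \<times> 'o \<times> 'm step list set"

text \<open>An arrow of the localization is a triple (domain, codomain, equivalence class of paths).\<close>

definition gz_class :: "('o, 'm) cat \<Rightarrow> 'm set \<Rightarrow> 'o \<Rightarrow> 'o \<Rightarrow> 'm step list \<Rightarrow> ('o, 'm) gz_arr" where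
  "gz_class C W x y p = (x, y, {q. gz_eq C W x y p q})"

definition GZ :: "('o, 'm) cat \<Rightarrow> 'm set \<Rightarrow> ('o, ('o, 'm) gz_arr) cat" where
  "GZ C W =
    \<lparr> Obj = Obj C,
      Arr = {gz_class C W x y p | x y p. path C W x p y},
      Dom = (\<lambda>(x, y, P). x),
      Cod = (\<lambda>(x, y, P). y),
      Ide = (\<lambda>x. gz_class C W x x []),
      Comp = (\<lambda>(y', z, Q) (x, y, P). (x, z, {r. \<exists>p\<in>P. \<exists>q\<in>Q. gz_eq C W x z (p @ q) r})) \<rparr>"

definition GZ_functor :: "('o, 'm) cat \<Rightarrow> 'm set \<Rightarrow> ('o, 'm, 'o, ('o, 'm) gz_arr) funct" where
  "GZ_functor C W =
    \<lparr> omap = (\<lambda>x. x), amap = (\<lambda>f. gz_class C W (Dom C f) (Cod C f) [Fwd f]) \<rparr>"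

lemma hom_iff: "f \<in> hom C x y \<longleftrightarrow> f \<in> Arr C \<and> Dom C f = x \<and> Cod C f = y"
  by (simp add: hom_def)

context category
begin

lemma path_objs: "path C W x p y \<Longrightarrow> x \<in> Obj C \<and> y \<in> Obj C"
proof (induction p arbitrary: x)
  case (Cons s p)
  then show ?case by (cases s) (auto simp: dom_obj cod_obj)
qed auto

lemma path_append: "path C W x p y \<Longrightarrow> path C W y q z \<Longrightarrow> path C W x (p @ q) z"
  by (induction C W x p y rule: path.induct) auto

lemma gz_eq_paths: "gz_eq C W x y p q \<Longrightarrow> path C W x p y \<and> path C W x q y"
proof (induction rule: gz_eq.induct)
  case (gz_comp f x y g z)
  then show ?case using comp_hom[OF gz_comp] by (auto simp: hom_iff cod_obj)
qed (use ide_hom in \<open>auto simp: path_append hom_iff dom_obj cod_obj\<close>)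

lemma gz_class_eq_iff:
  assumes "path C W x p y"
  shows "gz_class C W x y p = gz_class C W x y q \<longleftrightarrow> gz_eq C W x y p q"
  using assms by (auto simp: gz_class_def intro: gz_refl gz_sym gz_trans)

lemma Comp_gz_class:
  assumes "path C W x p y" "path C W y q z"
  shows "Comp (GZ C W) (gz_class C W y z q) (gz_class C W x y p) = gz_class C W x z (p @ q)"
  using assms
  by (auto simp: GZ_def gz_class_def intro: gz_refl gz_trans gz_append)

lemma hom_GZ: "hom (GZ C W) x y = {gz_class C W x y p | p. path C W x p y}"
  by (auto simp: GZ_def hom_def gz_class_def)

lemma category_GZ: "category (GZ C W)"
proof
  fix f assume "f \<in> Arr (GZ C W)"
  then show "Dom (GZ C W) f \<in> Obj (GZ C W)" "Cod (GZ C W) f \<in> Obj (GZ C W)"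
    by (auto simp: GZ_def gz_class_def dest: path_objs)
next
  fix x assume "x \<in> Obj (GZ C W)"
  then show "Ide (GZ C W) x \<in> hom (GZ C W) x x"
    unfolding hom_GZ by (auto simp: GZ_def intro!: exI[of _ "[]"])
next
  fix f x y g z assume "f \<in> hom (GZ C W) x y" "g \<in> hom (GZ C W) y z"
  then show "Comp (GZ C W) g f \<in> hom (GZ C W) x z"
    unfolding hom_GZ by (auto simp: Comp_gz_class path_append)
next
  fix f x y assume "f \<in> hom (GZ C W) x y"
  then obtain p where p: "f = gz_class C W x y p" "path C W x p y" by (auto simp: hom_GZ)
  have I: "Ide (GZ C W) v = gz_class C W v v []" for v by (simp add: GZ_def)
  have "path C W x [] x" "path C W y [] y" using path_objs[OF p(2)] by auto
  then show "Comp (GZ C W) f (Ide (GZ C W) x) = f" "Comp (GZ C W) (Ide (GZ C W) y) f = f"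
    using p(2) unfolding p(1) I by (simp_all add: Comp_gz_class)
next
  fix f x y g z h w
  assume "f \<in> hom (GZ C W) x y" "g \<in> hom (GZ C W) y z" "h \<in> hom (GZ C W) z w"
  then show "Comp (GZ C W) (Comp (GZ C W) h g) f = Comp (GZ C W) h (Comp (GZ C W) g f)"
    unfolding hom_GZ by (auto simp: Comp_gz_class path_append)
qed

lemma GZ_functor_is_functor: "cat_functor C (GZ C W) (GZ_functor C W)"
proof (intro cat_functor.intro cat_functor_axioms.intro category_GZ category_axioms)
  fix x assume x: "x \<in> Obj C"
  then show "omap (GZ_functor C W) x \<in> Obj (GZ C W)" by (simp add: GZ_def GZ_functor_def)
  have "gz_class C W x x [Fwd (Ide C x)] = gz_class C W x x []"
    using x ide_hom[OF x] by (subst gz_class_eq_iff) (auto simp: hom_iff intro: gz_ide)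
  then show "amap (GZ_functor C W) (Ide C x) = Ide (GZ C W) (omap (GZ_functor C W) x)"
    using ide_hom[OF x] by (simp add: GZ_def GZ_functor_def hom_iff)
next
  fix f x y assume "f \<in> hom C x y"
  then show "amap (GZ_functor C W) f \<in> hom (GZ C W) (omap (GZ_functor C W) x) (omap (GZ_functor C W) y)"
    by (auto simp: hom_GZ GZ_functor_def hom_iff cod_obj intro!: exI[of _ "[Fwd f]"])
next
  fix f x y g z assume fg: "f \<in> hom C x y" "g \<in> hom C y z"
  have "gz_class C W x z [Fwd f, Fwd g] = gz_class C W x z [Fwd (Comp C g f)]"
    using fg by (subst gz_class_eq_iff) (auto simp: hom_iff cod_obj intro: gz_comp)
  moreover have "path C W x [Fwd f] y" "path C W y [Fwd g] z" using fg by (auto simp: hom_iff cod_obj)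
  ultimately show "amap (GZ_functor C W) (Comp C g f) =
      Comp (GZ C W) (amap (GZ_functor C W) g) (amap (GZ_functor C W) f)"
    using fg comp_hom[OF fg] Comp_gz_class[of W x "[Fwd f]" y "[Fwd g]" z]
    by (simp add: GZ_functor_def hom_iff del: path.simps)
qed

lemma GZ_functor_inverse:
  assumes "w \<in> W" "w \<in> hom C x y"
  shows "inverse_arrows (GZ C W) (amap (GZ_functor C W) w) (gz_class C W y x [Bwd w])"
proof -
  have p: "path C W x [Fwd w] y" "path C W y [Bwd w] x"
    using assms by (auto simp: hom_iff dom_obj cod_obj)
  have e: "gz_class C W x x [Fwd w, Bwd w] = gz_class C W x x []"
    "gz_class C W y y [Bwd w, Fwd w] = gz_class C W y y []"
    using p assms by (auto simp: gz_class_eq_iff intro: gz_inv_left gz_inv_right)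
  have a: "amap (GZ_functor C W) w = gz_class C W x y [Fwd w]"
    using assms by (auto simp: GZ_functor_def hom_iff)
  have "gz_class C W x y [Fwd w] \<in> hom (GZ C W) x y" "gz_class C W y x [Bwd w] \<in> hom (GZ C W) y x"
    using p unfolding hom_GZ by auto
  then show ?thesis
    using p Comp_gz_class[OF p] Comp_gz_class[OF p(2,1)] e
    unfolding inverse_arrows_def a by (auto simp: hom_iff) (auto simp: GZ_def)
qed

lemma GZ_functor_inverts: "w \<in> W \<Longrightarrow> w \<in> Arr C \<Longrightarrow> is_iso (GZ C W) (amap (GZ_functor C W) w)"
  unfolding is_iso_def using GZ_functor_inverse[of w W "Dom C w" "Cod C w"] by (fastforce simp: hom_iff)

end

fun path_image ::
    "('o, 'm) cat \<Rightarrow> ('p, 'n) cat \<Rightarrow> ('o, 'm, 'p, 'n) funct \<Rightarrow> 'o \<Rightarrow> 'm step list \<Rightarrow> 'n" where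
  "path_image C D F x [] = Ide D (omap F x)"
| "path_image C D F x (Fwd f # p) = Comp D (path_image C D F (Cod C f) p) (amap F f)"
| "path_image C D F x (Bwd w # p) =
     Comp D (path_image C D F (Dom C w) p) (SOME g. inverse_arrows D (amap F w) g)"

lemma (in category) inverse_arrows_unique:
  assumes "inverse_arrows C f g" "inverse_arrows C f h"
  shows "g = h"
proof -
  let ?x = "Dom C f" and ?y = "Cod C f"
  have f: "f \<in> hom C ?x ?y" and g: "g \<in> hom C ?y ?x" and h: "h \<in> hom C ?y ?x"
    using assms by (auto simp: inverse_arrows_def hom_iff)
  have "g = g \<cdot> (f \<cdot> h)" using assms ide_right[OF g] by (simp add: inverse_arrows_def)
  also have "\<dots> = (g \<cdot> f) \<cdot> h" using comp_assoc[OF h f g] by simp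
  also have "\<dots> = h" using assms ide_left[OF h] by (simp add: inverse_arrows_def)
  finally show ?thesis .
qed

lemma (in cat_functor) functor_inverse:
  assumes "inverse_arrows A f g"
  shows "inverse_arrows B (amap F f) (amap F g)"
proof -
  let ?x = "Dom A f" and ?y = "Cod A f"
  have f: "f \<in> hom A ?x ?y" and g: "g \<in> hom A ?y ?x"
    using assms by (auto simp: inverse_arrows_def hom_iff)
  have "?x \<in> Obj A" "?y \<in> Obj A" using f A.dom_obj A.cod_obj by (auto simp: hom_iff)
  then show ?thesis
    using assms amap_hom[OF f] amap_hom[OF g] amap_comp[OF f g] amap_comp[OF g f]
    by (auto simp: inverse_arrows_def hom_iff amap_ide)
qed

text \<open>
  The universal property: every functor inverting \<open>W\<close> factors through the localization, and the
  factorization is unique (equality of functors means equality on objects and arrows).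
\<close>

theorem GZ_universal:
  fixes F :: "('o, 'm, 'p, 'n) funct"
  assumes F: "cat_functor C D F"
    and inv: "\<And>w. w \<in> W \<Longrightarrow> w \<in> Arr C \<Longrightarrow> is_iso D (amap F w)"
  shows "\<exists>G. cat_functor (GZ C W) D G \<and>
      (\<forall>x\<in>Obj C. omap G (omap (GZ_functor C W) x) = omap F x) \<and>
      (\<forall>f\<in>Arr C. amap G (amap (GZ_functor C W) f) = amap F f)"
    and "\<lbrakk>cat_functor (GZ C W) D G; cat_functor (GZ C W) D G';
      \<And>x. x \<in> Obj C \<Longrightarrow> omap G (omap (GZ_functor C W) x) = omap F x;
      \<And>x. x \<in> Obj C \<Longrightarrow> omap G' (omap (GZ_functor C W) x) = omap F x;
      \<And>f. f \<in> Arr C \<Longrightarrow> amap G (amap (GZ_functor C W) f) = amap F f;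
      \<And>f. f \<in> Arr C \<Longrightarrow> amap G' (amap (GZ_functor C W) f) = amap F f\<rbrakk> \<Longrightarrow>
      (\<forall>x\<in>Obj (GZ C W). omap G x = omap G' x) \<and> (\<forall>a\<in>Arr (GZ C W). amap G a = amap G' a)"
proof -
  interpret F: cat_functor C D F by fact
  let ?ev = "path_image C D F" and ?i = "\<lambda>w. SOME g. inverse_arrows D (amap F w) g"
  have i: "inverse_arrows D (amap F w) (?i w)" if "w \<in> W" "w \<in> Arr C" for w
    using inv[OF that] unfolding is_iso_def by (rule someI_ex)
  have Fhom: "amap F f \<in> hom D (omap F (Dom C f)) (omap F (Cod C f))" if "f \<in> Arr C" for f
    using that F.amap_hom by (simp add: hom_iff)
  have ihom: "?i w \<in> hom D (omap F (Cod C w)) (omap F (Dom C w))" if "w \<in> W" "w \<in> Arr C" for w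
    using i[OF that] Fhom[OF that(2)] by (auto simp: inverse_arrows_def hom_iff)
  have i_left: "Comp D (?i w) (amap F w) = Ide D (omap F (Dom C w))"
    and i_right: "Comp D (amap F w) (?i w) = Ide D (omap F (Cod C w))" if "w \<in> W" "w \<in> Arr C" for w
    using i[OF that] Fhom[OF that(2)] by (auto simp: inverse_arrows_def hom_iff)
  have ev_hom: "?ev x p \<in> hom D (omap F x) (omap F y)" if "path C W x p y" for x p y
    using that
  proof (induction p arbitrary: x)
    case Nil
    then show ?case by (auto intro: F.B.ide_hom F.omap_obj)
  next
    case (Cons s p)
    show ?case
    proof (cases s)
      case (Fwd f)
      then show ?thesis using Cons.prems F.B.comp_hom[OF Fhom Cons.IH] by auto
    next
      case (Bwd w)
      then show ?thesis using Cons.prems F.B.comp_hom[OF ihom Cons.IH] by auto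
    qed
  qed
  have ev_append: "?ev x (p @ q) = Comp D (?ev y q) (?ev x p)"
    if "path C W x p y" "path C W y q z" for x p y q z
    using that(1)
  proof (induction p arbitrary: x)
    case Nil
    then show ?case using F.B.ide_right[OF ev_hom[OF that(2)]] by auto
  next
    case (Cons s p)
    show ?case
    proof (cases s)
      case (Fwd f)
      then show ?thesis
        using Cons F.B.comp_assoc[OF Fhom[of f] ev_hom[of "Cod C f" p y] ev_hom[OF that(2)]] by auto
    next
      case (Bwd w)
      then show ?thesis
        using Cons F.B.comp_assoc[OF ihom[of w] ev_hom[of "Dom C w" p y] ev_hom[OF that(2)]] by auto
    qed
  qed
  have idl: "Comp D (Ide D y) g = g" if "g \<in> hom D x y" for g x y
    using F.B.ide_left[OF that] .
  have ev_eq: "?ev x p = ?ev x q" if "gz_eq C W x y p q" for x y p q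
    using that
  proof (induction rule: gz_eq.induct)
    case (gz_append x y p q z p' q')
    then show ?case
      using F.A.gz_eq_paths[OF gz_append(1)] F.A.gz_eq_paths[OF gz_append(2)]
      by (metis ev_append)
  next
    case (gz_ide x)
    then have "Ide C x \<in> hom C x x" by (rule F.A.ide_hom)
    then show ?case
      using gz_ide F.amap_ide[OF gz_ide] idl[OF F.B.ide_hom[OF F.omap_obj[OF gz_ide]]]
      by (simp add: hom_iff)
  next
    case (gz_comp f x y g z)
    have gf: "Comp C g f \<in> hom C x z" using gz_comp by (rule F.A.comp_hom)
    show ?case
      using gz_comp gf F.amap_comp[OF gz_comp] idl[OF F.amap_hom[OF gf]] idl[OF F.amap_hom[OF gz_comp(2)]]
      by (simp add: hom_iff)
  next
    case (gz_inv_right w x y)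
    then have w: "w \<in> Arr C" "Dom C w = x" "Cod C w = y" by (auto simp: hom_iff)
    show ?case
      using i_left[OF gz_inv_right(1) w(1)] idl[OF ihom[OF gz_inv_right(1) w(1)]] w by simp
  next
    case (gz_inv_left w x y)
    then have w: "w \<in> Arr C" "Dom C w = x" "Cod C w = y" by (auto simp: hom_iff)
    show ?case
      using i_right[OF gz_inv_left(1) w(1)] idl[OF Fhom[OF w(1)]] w by simp
  qed auto
  define G where "G = \<lparr> omap = omap F, amap = (\<lambda>(x, y :: 'o, P). ?ev x (SOME p. p \<in> P)) \<rparr>"
  have G: "amap G (gz_class C W x y p) = ?ev x p" if "path C W x p y" for x y p
  proof -
    have "gz_eq C W x y p (SOME q. gz_eq C W x y p q)"
      using gz_refl[OF that] by (rule someI)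
    then show ?thesis using ev_eq by (simp add: G_def gz_class_def)
  qed
  have Go: "omap G x = omap F x" for x by (simp add: G_def)
  have "cat_functor (GZ C W) D G"
  proof (intro cat_functor.intro cat_functor_axioms.intro F.A.category_GZ F.B.category_axioms)
    fix x assume "x \<in> Obj (GZ C W)"
    then have x: "x \<in> Obj C" by (simp add: GZ_def)
    show "omap G x \<in> Obj D" using F.omap_obj[OF x] by (simp add: Go)
    show "amap G (Ide (GZ C W) x) = Ide D (omap G x)"
      using G[of x "[]" x] x by (simp add: Go) (simp add: GZ_def)
  next
    fix f x y assume "f \<in> hom (GZ C W) x y"
    then show "amap G f \<in> hom D (omap G x) (omap G y)"
      by (auto simp: F.A.hom_GZ G Go ev_hom)
  next
    fix f x y g z assume "f \<in> hom (GZ C W) x y" "g \<in> hom (GZ C W) y z"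
    then show "amap G (Comp (GZ C W) g f) = Comp D (amap G g) (amap G f)"
      by (auto simp: F.A.hom_GZ F.A.Comp_gz_class G F.A.path_append ev_append)
  qed
  moreover have "amap G (amap (GZ_functor C W) f) = amap F f" if f: "f \<in> Arr C" for f
    using G[of "Dom C f" "[Fwd f]" "Cod C f"] f idl[OF Fhom[OF f]] F.A.cod_obj[OF f]
    by (simp add: GZ_functor_def)
  ultimately show "\<exists>G. cat_functor (GZ C W) D G \<and>
      (\<forall>x\<in>Obj C. omap G (omap (GZ_functor C W) x) = omap F x) \<and>
      (\<forall>f\<in>Arr C. amap G (amap (GZ_functor C W) f) = amap F f)"
    by (intro exI[of _ G]) (simp add: Go GZ_functor_def)
next
  assume *: "cat_functor (GZ C W) D G" "cat_functor (GZ C W) D G'"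
    "\<And>x. x \<in> Obj C \<Longrightarrow> omap G (omap (GZ_functor C W) x) = omap F x"
    "\<And>x. x \<in> Obj C \<Longrightarrow> omap G' (omap (GZ_functor C W) x) = omap F x"
    "\<And>f. f \<in> Arr C \<Longrightarrow> amap G (amap (GZ_functor C W) f) = amap F f"
    "\<And>f. f \<in> Arr C \<Longrightarrow> amap G' (amap (GZ_functor C W) f) = amap F f"
  interpret F: cat_functor C D F by fact
  interpret G: cat_functor "GZ C W" D G by fact
  interpret G': cat_functor "GZ C W" D G' by fact
  have o: "omap G x = omap G' x" if "x \<in> Obj C" for x
    using *(3,4)[OF that] by (simp add: GZ_functor_def)
  have cons: "amap H (gz_class C W x y (s # p)) =
      Comp D (amap H (gz_class C W x' y p)) (amap H (gz_class C W x x' [s]))"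
    if H: "cat_functor (GZ C W) D H" and "path C W x [s] x'" "path C W x' p y" for H x x' y s p
  proof -
    interpret H: cat_functor "GZ C W" D H by fact
    have h: "gz_class C W x x' [s] \<in> hom (GZ C W) x x'" "gz_class C W x' y p \<in> hom (GZ C W) x' y"
      using that by (auto simp: F.A.hom_GZ)
    show ?thesis using H.amap_comp[OF h] F.A.Comp_gz_class[OF that(2,3)] by simp
  qed
  have "amap G (gz_class C W x y p) = amap G' (gz_class C W x y p)" if "path C W x p y" for x y p
    using that
  proof (induction p arbitrary: x)
    case Nil
    then have y: "y \<in> Obj (GZ C W)" "y \<in> Obj C" "x = y" by (auto simp: GZ_def)
    then show ?case using G.amap_ide[OF y(1)] G'.amap_ide[OF y(1)] o[OF y(2)] by (simp add: GZ_def)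
  next
    case (Cons s p)
    have "\<exists>x'. path C W x [s] x' \<and> path C W x' p y \<and>
        amap G (gz_class C W x x' [s]) = amap G' (gz_class C W x x' [s])"
    proof (cases s)
      case (Fwd f)
      then show ?thesis using Cons.prems *(5,6)[of f] F.A.cod_obj
        by (auto simp: GZ_functor_def)
    next
      case (Bwd w)
      then have w: "w \<in> W" "w \<in> hom C (Dom C w) x" "w \<in> Arr C" using Cons.prems by (auto simp: hom_iff)
      note I = F.A.GZ_functor_inverse[OF w(1,2)]
      have "amap G (gz_class C W x (Dom C w) [Bwd w]) = amap G' (gz_class C W x (Dom C w) [Bwd w])"
        using G.functor_inverse[OF I] G'.functor_inverse[OF I] *(5,6)[OF w(3)]
          F.B.inverse_arrows_unique by auto
      then show ?thesis using Bwd Cons.prems F.A.dom_obj by auto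
    qed
    then show ?case using Cons.IH cons[OF *(1)] cons[OF *(2)] by metis
  qed
  then show "(\<forall>x\<in>Obj (GZ C W). omap G x = omap G' x) \<and> (\<forall>a\<in>Arr (GZ C W). amap G a = amap G' a)"
    using o by (auto simp: GZ_def)
qed

end

theory Submission
  imports Defs
begin

text \<open>
  Let \<open>X\<close> be cofibrant and \<open>Y\<close> fibrant.  Two facts about the localization carry the proof: every
  arrow \<open>X \<rightarrow> Y\<close> of the localization is the image of an arrow of the model category, and two
  arrows \<open>u, v : X \<rightarrow> Y\<close> have the same image exactly if they are right homotopic through one
  path object \<open>P\<close> of \<open>Y\<close>, chosen once and for all.  Given a coproduct \<open>c\<close> of objects \<open>X i\<close>,
  resolve each \<open>X i\<close> by a trivial fibration \<open>Z i \<rightarrow> X i\<close> with \<open>Z i\<close> cofibrant.  The coproduct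
  \<open>c'\<close> of the \<open>Z i\<close> is cofibrant, and \<open>c' \<rightarrow> c\<close> is a weak equivalence because weak equivalences
  are closed under coproducts.  So, after a fibrant replacement of the target, a family of arrows
  of the localization out of the \<open>X i\<close> becomes a family of honest arrows \<open>Z i \<rightarrow> Y\<close>, which
  extends to \<open>c'\<close> (\<open>paths_copair\<close>).  Uniqueness holds because the homotopies \<open>Z i \<rightarrow> P\<close>
  between two candidates, all of them into the same \<open>P\<close>, are the components of one arrow
  \<open>c' \<rightarrow> P\<close> (\<open>homotopic_coproduct\<close>, \<open>paths_copair_unique\<close>).

  No pushouts or pullbacks are assumed, so homotopies cannot be glued.  Their place is taken by
  \<open>homotopic_if_equal_along_tfib\<close>: if \<open>p \<cdot> k = p \<cdot> l\<close> for a trivial fibration \<open>p\<close>, then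
  \<open>b \<cdot> k\<close> and \<open>b \<cdot> l\<close> are right homotopic for every \<open>b\<close> into \<open>Y\<close>.  Applied to the
  endpoint projection \<open>P \<rightarrow> Y\<close> this makes right homotopy an equivalence relation; applied to
  resolutions it makes the assignment of \<open>{Z \<rightarrow> Y} / \<simeq>\<close> to \<open>X\<close>, for a resolution
  \<open>Z \<rightarrow> X\<close>, a presheaf.  This presheaf sends weak equivalences to bijections, so it is defined on
  the localization, where it is represented by \<open>Y\<close>: this gives the two facts above.
  It appears below as a relation between elements, the transport along a path, which treats formal
  inverses as converse relations.

  Products follow by passing to the opposite category, whose localization is the opposite of the
  localization, paths being read backwards.
\<close>

section \<open>Duality\<close>

definition op_cat :: "('o, 'm) cat \<Rightarrow> ('o, 'm) cat" where
  "op_cat C = \<lparr>Obj = Obj C, Arr = Arr C, Dom = Cod C, Cod = Dom C, Ide = Ide C,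
     Comp = (\<lambda>g f. Comp C f g)\<rparr>"

lemma op_cat_simps [simp]:
  "Obj (op_cat C) = Obj C" "Arr (op_cat C) = Arr C" "Dom (op_cat C) = Cod C"
  "Cod (op_cat C) = Dom C" "Ide (op_cat C) = Ide C" "Comp (op_cat C) g f = Comp C f g"
  by (simp_all add: op_cat_def)

lemma op_cat_op_cat [simp]: "op_cat (op_cat C) = C"
  by (simp add: op_cat_def)

lemma hom_op_cat [simp]: "hom (op_cat C) x y = hom C y x"
  by (auto simp: hom_def)

lemma category_op_cat: "category C \<Longrightarrow> category (op_cat C)"
  unfolding category_def by (auto simp: hom_iff)

lemma is_coproduct_op_cat: "is_coproduct (op_cat C) I X c \<iota> \<longleftrightarrow> is_product C I X c \<iota>"
  by (simp add: is_coproduct_def is_product_def)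

lemma is_product_op_cat: "is_product (op_cat C) I X c \<pi> \<longleftrightarrow> is_coproduct C I X c \<pi>"
  by (simp add: is_coproduct_def is_product_def)

lemma has_coproducts_op_cat: "has_coproducts (op_cat C) I \<longleftrightarrow> has_products C I"
  by (simp add: has_coproducts_def has_products_def is_coproduct_op_cat)

lemma has_products_op_cat: "has_products (op_cat C) I \<longleftrightarrow> has_coproducts C I"
  by (simp add: has_coproducts_def has_products_def is_product_op_cat)

lemma closed_under_coproducts_op_cat:
  "closed_under_coproducts (op_cat C) I W \<longleftrightarrow> closed_under_products C I W"
  unfolding closed_under_coproducts_def closed_under_products_def is_coproduct_op_cat
  by (simp, rule iffI; metis)

lemma wide_subcategory_op_cat: "wide_subcategory C S \<Longrightarrow> wide_subcategory (op_cat C) S"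
  unfolding wide_subcategory_def op_cat_simps by metis

lemma two_of_three_op_cat:
  assumes "two_of_three C S" shows "two_of_three (op_cat C) S"
  unfolding two_of_three_def op_cat_simps
proof (intro ballI impI)
  fix f g assume *: "f \<in> Arr C" "g \<in> Arr C" "Dom C f = Cod C g"
  show "(f \<in> S \<and> g \<in> S \<longrightarrow> Comp C f g \<in> S) \<and>
      (f \<in> S \<and> Comp C f g \<in> S \<longrightarrow> g \<in> S) \<and> (g \<in> S \<and> Comp C f g \<in> S \<longrightarrow> f \<in> S)"
    using assms[unfolded two_of_three_def, THEN bspec, OF *(2), THEN bspec, OF *(1), THEN mp,
        OF *(3)[symmetric]] by blast
qed

lemma closed_under_retracts_op_cat:
  assumes "closed_under_retracts C S" shows "closed_under_retracts (op_cat C) S"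
proof -
  have "is_retract C f g" if r: "is_retract (op_cat C) f g" for f g
  proof -
    obtain i r j q where "f \<in> Arr C" "g \<in> Arr C"
      "i \<in> hom C (Cod C g) (Cod C f)" "r \<in> hom C (Cod C f) (Cod C g)"
      "j \<in> hom C (Dom C g) (Dom C f)" "q \<in> hom C (Dom C f) (Dom C g)"
      "Comp C i g = Comp C f j" "Comp C r f = Comp C g q"
      "Comp C i r = Ide C (Cod C f)" "Comp C j q = Ide C (Dom C f)"
      using r unfolding is_retract_def by auto
    then show ?thesis
      unfolding is_retract_def
      by (intro conjI bexI[of _ q] bexI[of _ j] bexI[of _ r] bexI[of _ i]) simp_all
  qed
  then show ?thesis using assms unfolding closed_under_retracts_def by blast
qed

lemma has_lifting_op_cat:
  assumes "has_lifting C L R" shows "has_lifting (op_cat C) R L"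
  unfolding has_lifting_def op_cat_simps hom_op_cat
proof (intro ballI impI)
  fix p i b a
  assume "p \<in> R" "i \<in> L" "b \<in> hom C (Cod C i) (Cod C p)" "a \<in> hom C (Dom C i) (Dom C p)"
    "Comp C b i = Comp C p a"
  then show "\<exists>h\<in>hom C (Cod C i) (Dom C p). Comp C p h = b \<and> Comp C h i = a"
    using assms[unfolded has_lifting_def, rule_format, of i p a b] by auto
qed

lemma has_factorization_op_cat:
  assumes "has_factorization C L R" shows "has_factorization (op_cat C) R L"
  unfolding has_factorization_def op_cat_simps
proof
  fix f assume "f \<in> Arr C"
  then obtain i p where "i \<in> L" "p \<in> R" "Cod C i = Dom C p" "f = Comp C p i"
    using assms unfolding has_factorization_def by blast
  then show "\<exists>p\<in>R. \<exists>i\<in>L. Dom C p = Cod C i \<and> f = Comp C p i" by metis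
qed

lemma model_structure_op_cat:
  assumes "model_structure C Cofib Fib Weq"
  shows "model_structure (op_cat C) Fib Cofib Weq"
proof -
  interpret model_structure C Cofib Fib Weq by fact
  show ?thesis
    unfolding model_structure_def model_structure_axioms_def
    using category_op_cat[OF category_axioms] cofib_wide[THEN wide_subcategory_op_cat]
      fib_wide[THEN wide_subcategory_op_cat] weq_wide[THEN wide_subcategory_op_cat]
      CM1[THEN two_of_three_op_cat] CM2_cofib[THEN closed_under_retracts_op_cat]
      CM2_fib[THEN closed_under_retracts_op_cat] CM2_weq[THEN closed_under_retracts_op_cat]
      CM3_cofib[THEN has_lifting_op_cat] CM3_fib[THEN has_lifting_op_cat]
      CM4_cofib[THEN has_factorization_op_cat] CM4_fib[THEN has_factorization_op_cat]
    by blast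
qed


section \<open>Lifting properties, cylinders and path objects\<close>

context category
begin

lemma comp_in_homI [intro]: "f \<in> hom C x y \<Longrightarrow> g \<in> hom C y z \<Longrightarrow> g \<cdot> f \<in> hom C x z"
  by (rule comp_hom)

lemma hom_objs: "f \<in> hom C x y \<Longrightarrow> x \<in> Obj C" "f \<in> hom C x y \<Longrightarrow> y \<in> Obj C"
  by (auto simp: hom_iff dom_obj cod_obj)

lemma hom_self: "f \<in> Arr C \<Longrightarrow> f \<in> hom C (Dom C f) (Cod C f)"
  by (simp add: hom_iff)

lemma coproduct_ex:
  assumes "is_coproduct C I X c \<iota>" "d \<in> Obj C" "\<And>i. i \<in> I \<Longrightarrow> f i \<in> hom C (X i) d"
  obtains h where "h \<in> hom C c d" "\<And>i. i \<in> I \<Longrightarrow> h \<cdot> \<iota> i = f i"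
proof -
  have "\<exists>!h. h \<in> hom C c d \<and> (\<forall>i\<in>I. h \<cdot> \<iota> i = f i)"
    using assms unfolding is_coproduct_def by simp
  then show ?thesis using that by blast
qed

lemma coproduct_eqI:
  assumes "is_coproduct C I X c \<iota>" "h \<in> hom C c d" "h' \<in> hom C c d"
    "\<And>i. i \<in> I \<Longrightarrow> h \<cdot> \<iota> i = h' \<cdot> \<iota> i"
  shows "h = h'"
proof -
  have \<iota>: "\<iota> i \<in> hom C (X i) c" if "i \<in> I" for i
    using assms(1) that by (simp add: is_coproduct_def)
  have "\<exists>!k. k \<in> hom C c d \<and> (\<forall>i\<in>I. k \<cdot> \<iota> i = h' \<cdot> \<iota> i)"
    using assms(1)[unfolded is_coproduct_def, THEN conjunct2, THEN conjunct2, rule_format,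
        OF hom_objs(2)[OF assms(2)], of "\<lambda>i. h' \<cdot> \<iota> i"] comp_hom[OF \<iota> assms(3)] by simp
  then show ?thesis using assms(2-4) by (elim ex1E) auto
qed

end

locale model_category = model_structure C Cofib Fib Weq
  for C :: "('o, 'm) cat" (structure) and Cofib Fib Weq :: "'m set" +
  assumes finite_products: "has_finite_products C"
    and finite_coproducts: "has_finite_coproducts C"
begin

lemma model_category_op_cat: "model_category (op_cat C) Fib Cofib Weq"
proof (intro model_category.intro model_category_axioms.intro)
  show "model_structure (op_cat C) Fib Cofib Weq"
    by (rule model_structure_op_cat) (rule model_structure_axioms)
  show "has_finite_products (op_cat C)"
    using finite_coproducts by (simp add: has_finite_products_def has_finite_coproducts_def has_products_op_cat)
  show "has_finite_coproducts (op_cat C)"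
    using finite_products by (simp add: has_finite_products_def has_finite_coproducts_def has_coproducts_op_cat)
qed

text \<open>
  Phrased by lifting rather than by the arrow from the initial object or to the terminal one, the
  two notions are exchanged by duality literally, and cofibrancy of a coproduct is immediate from
  that of the summands.
\<close>

definition cofibrant :: "'o \<Rightarrow> bool" where
  "cofibrant z \<longleftrightarrow> z \<in> Obj C \<and>
     (\<forall>p\<in>Fib \<inter> Weq. \<forall>b\<in>hom C z (Cod C p). \<exists>a\<in>hom C z (Dom C p). p \<cdot> a = b)"

definition fibrant :: "'o \<Rightarrow> bool" where
  "fibrant y \<longleftrightarrow> y \<in> Obj C \<and>
     (\<forall>i\<in>Cofib \<inter> Weq. \<forall>a\<in>hom C (Dom C i) y. \<exists>b\<in>hom C (Cod C i) y. b \<cdot> i = a)"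

lemma cofibrantD:
  assumes "cofibrant z" "p \<in> hom C v w" "p \<in> Fib \<inter> Weq" "b \<in> hom C z w"
  obtains a where "a \<in> hom C z v" "p \<cdot> a = b"
proof -
  have "v = Dom C p" "w = Cod C p" using assms(2) by (auto simp: hom_iff)
  then show ?thesis using assms that unfolding cofibrant_def by blast
qed

lemma fibrantD:
  assumes "fibrant y" "i \<in> hom C v w" "i \<in> Cofib \<inter> Weq" "a \<in> hom C v y"
  obtains b where "b \<in> hom C w y" "b \<cdot> i = a"
proof -
  have "v = Dom C i" "w = Cod C i" using assms(2) by (auto simp: hom_iff)
  then show ?thesis using assms that unfolding fibrant_def by blast
qed

lemma cofibrant_obj: "cofibrant z \<Longrightarrow> z \<in> Obj C"
  by (simp add: cofibrant_def)

lemma class_arr: "f \<in> Cofib \<Longrightarrow> f \<in> Arr C" "f \<in> Fib \<Longrightarrow> f \<in> Arr C" "f \<in> Weq \<Longrightarrow> f \<in> Arr C"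
  using cofib_wide fib_wide weq_wide by (auto simp: wide_subcategory_def)

lemma ide_class: "x \<in> Obj C \<Longrightarrow> Ide C x \<in> Cofib \<inter> Fib \<inter> Weq"
  using cofib_wide fib_wide weq_wide by (auto simp: wide_subcategory_def)

lemma wide_subcategory_comp:
  assumes "wide_subcategory C S" "f \<in> hom C x y" "g \<in> hom C y z" "f \<in> S" "g \<in> S"
  shows "g \<cdot> f \<in> S"
proof -
  have "Cod C f = Dom C g" using assms(2,3) by (simp add: hom_iff)
  then show ?thesis using assms unfolding wide_subcategory_def by blast
qed

lemmas cofib_comp = wide_subcategory_comp[OF cofib_wide]

lemma weq_two_of_three:
  assumes "f \<in> hom C x y" "g \<in> hom C y z"
  shows weq_cancel_left: "g \<in> Weq \<Longrightarrow> g \<cdot> f \<in> Weq \<Longrightarrow> f \<in> Weq"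
    and weq_comp: "f \<in> Weq \<Longrightarrow> g \<in> Weq \<Longrightarrow> g \<cdot> f \<in> Weq"
proof -
  have "f \<in> Arr C" "g \<in> Arr C" "Cod C f = Dom C g" using assms by (auto simp: hom_iff)
  then show "g \<in> Weq \<Longrightarrow> g \<cdot> f \<in> Weq \<Longrightarrow> f \<in> Weq"
      "f \<in> Weq \<Longrightarrow> g \<in> Weq \<Longrightarrow> g \<cdot> f \<in> Weq"
    using CM1 unfolding two_of_three_def by blast+
qed

lemma lift_cofib:
  assumes "i \<in> hom C x y" "p \<in> hom C v w" "i \<in> Cofib" "p \<in> Fib \<inter> Weq"
    "a \<in> hom C x v" "b \<in> hom C y w" "p \<cdot> a = b \<cdot> i"
  obtains h where "h \<in> hom C y v" "h \<cdot> i = a" "p \<cdot> h = b"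
proof -
  have "x = Dom C i" "y = Cod C i" "v = Dom C p" "w = Cod C p"
    using assms(1,2) by (auto simp: hom_iff)
  then show ?thesis using CM3_cofib assms that unfolding has_lifting_def by blast
qed

lemma factor_cofib:
  assumes "f \<in> hom C x y"
  obtains z i p where "i \<in> hom C x z" "p \<in> hom C z y" "i \<in> Cofib" "p \<in> Fib \<inter> Weq" "f = p \<cdot> i"
proof -
  have "f \<in> Arr C" using assms by (simp add: hom_iff)
  then obtain i p where ip: "i \<in> Cofib" "p \<in> Fib \<inter> Weq" "Cod C i = Dom C p" "f = p \<cdot> i"
    using CM4_cofib unfolding has_factorization_def by blast
  have i: "i \<in> hom C (Dom C i) (Dom C p)" and p: "p \<in> hom C (Dom C p) (Cod C p)"
    using ip class_arr by (auto simp: hom_iff)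
  then have "x = Dom C i" "y = Cod C p"
    using comp_hom[OF i p] assms ip by (auto simp: hom_iff)
  then show ?thesis using that ip i p by blast
qed

text \<open>
  The retract argument.  Factor \<open>f = p \<cdot> i\<close> and lift \<open>f\<close> against \<open>p\<close>; the lift exhibits \<open>f\<close> as a
  retract of the cofibration \<open>i\<close>.
\<close>

lemma cofib_if_lifting:
  assumes f: "f \<in> hom C x y"
    and lift: "\<And>p v w a b. \<lbrakk>p \<in> hom C v w; p \<in> Fib \<inter> Weq; a \<in> hom C x v; b \<in> hom C y w; p \<cdot> a = b \<cdot> f\<rbrakk>
      \<Longrightarrow> \<exists>h\<in>hom C y v. h \<cdot> f = a \<and> p \<cdot> h = b"
  shows "f \<in> Cofib"
proof -
  obtain z i p where i: "i \<in> hom C x z" "i \<in> Cofib" and p: "p \<in> hom C z y" "p \<in> Fib \<inter> Weq"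
    and fip: "f = p \<cdot> i"
    using f by (rule factor_cofib)
  have xy: "x \<in> Obj C" "y \<in> Obj C" using hom_objs f by auto
  have "p \<cdot> i = Ide C y \<cdot> f" using ide_left f fip by simp
  then obtain h where h: "h \<in> hom C y z" "h \<cdot> f = i" "p \<cdot> h = Ide C y"
    using lift[OF p i(1) ide_hom[OF xy(2)]] by blast
  have *: "Dom C f = x" "Cod C f = y" "Dom C i = x" "Cod C i = z" "f \<in> Arr C" "i \<in> Arr C"
    using f i by (auto simp: hom_iff)
  have "is_retract C f i"
    unfolding is_retract_def *
  proof (intro conjI * bexI)
    show "i \<cdot> Ide C x = h \<cdot> f" "f \<cdot> Ide C x = p \<cdot> i" "Ide C x \<cdot> Ide C x = Ide C x"
      using h i f fip ide_right ide_hom[OF xy(1)] by auto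
  qed (use h p ide_hom xy in auto)
  then show ?thesis using CM2_cofib i(2) unfolding closed_under_retracts_def by blast
qed

lemma cofibrant_extend:
  assumes "cofibrant x" "i \<in> hom C x z" "i \<in> Cofib"
  shows "cofibrant z"
  unfolding cofibrant_def
proof (intro conjI ballI)
  show "z \<in> Obj C" using hom_objs assms(2) by auto
  fix p b assume p: "p \<in> Fib \<inter> Weq" and b: "b \<in> hom C z (Cod C p)"
  have ph: "p \<in> hom C (Dom C p) (Cod C p)" using p class_arr hom_self by auto
  obtain a where a: "a \<in> hom C x (Dom C p)" "p \<cdot> a = b \<cdot> i"
    using cofibrantD[OF assms(1) ph p comp_hom[OF assms(2) b]] .
  obtain h where "h \<in> hom C z (Dom C p)" "p \<cdot> h = b"
    using lift_cofib[OF assms(2) ph assms(3) p a(1) b a(2)] .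
  then show "\<exists>a\<in>hom C z (Dom C p). p \<cdot> a = b" by blast
qed

lemma cofibrant_coproduct:
  assumes c: "is_coproduct C I Z c \<kappa>" and Z: "\<And>i. i \<in> I \<Longrightarrow> cofibrant (Z i)"
  shows "cofibrant c"
  unfolding cofibrant_def
proof (intro conjI ballI)
  show "c \<in> Obj C" using c by (simp add: is_coproduct_def)
  have \<kappa>: "\<kappa> i \<in> hom C (Z i) c" if "i \<in> I" for i
    using c that by (simp add: is_coproduct_def)
  fix p b assume p: "p \<in> Fib \<inter> Weq" and b: "b \<in> hom C c (Cod C p)"
  have ph: "p \<in> hom C (Dom C p) (Cod C p)" using p class_arr hom_self by auto
  have "\<exists>a. a \<in> hom C (Z i) (Dom C p) \<and> p \<cdot> a = b \<cdot> \<kappa> i" if "i \<in> I" for i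
    using cofibrantD[OF Z[OF that] ph p comp_hom[OF \<kappa>[OF that] b]] by blast
  then obtain a where a: "\<And>i. i \<in> I \<Longrightarrow> a i \<in> hom C (Z i) (Dom C p) \<and> p \<cdot> a i = b \<cdot> \<kappa> i"
    by metis
  obtain h where h: "h \<in> hom C c (Dom C p)" "\<And>i. i \<in> I \<Longrightarrow> h \<cdot> \<kappa> i = a i"
    using coproduct_ex[OF c] hom_objs(1)[OF ph] a by metis
  have "p \<cdot> h = b"
  proof (rule coproduct_eqI[OF c comp_hom[OF h(1) ph] b])
    fix i assume "i \<in> I"
    then show "(p \<cdot> h) \<cdot> \<kappa> i = b \<cdot> \<kappa> i"
      using comp_assoc[OF \<kappa> h(1) ph] h(2) a by simp
  qed
  then show "\<exists>a\<in>hom C c (Dom C p). p \<cdot> a = b" using h by blast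
qed

lemma cofibrant_replacement:
  assumes "x \<in> Obj C"
  obtains z q where "cofibrant z" "q \<in> hom C z x" "q \<in> Fib \<inter> Weq"
proof -
  obtain e \<iota> where e: "is_coproduct C ({} :: nat set) (\<lambda>_. x) e \<iota>"
    using finite_coproducts unfolding has_finite_coproducts_def has_coproducts_def by force
  obtain f where f: "f \<in> hom C e x" using coproduct_ex[OF e assms] by blast
  obtain z i q where i: "i \<in> hom C e z" "i \<in> Cofib" and q: "q \<in> hom C z x" "q \<in> Fib \<inter> Weq"
    using f by (rule factor_cofib)
  have "cofibrant e" using cofibrant_coproduct[OF e] by blast
  then show ?thesis using that q cofibrant_extend i by blast
qed

text \<open>
  Factor the codiagonal of \<open>z\<close> as a cofibration followed by a trivial fibration \<open>\<sigma>\<close>.  The first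
  injection of \<open>z\<close> into the coproduct of two copies is a cofibration because the lift can be chosen
  freely on the second, cofibrant copy; hence so is \<open>i0\<close>, a weak equivalence since
  \<open>\<sigma> \<cdot> i0\<close> is an identity.  The last clause says that the two ends together form a cofibration,
  in a form that does not mention the coproduct and can be dualized as it stands.
\<close>

lemma cylinder:
  assumes z: "cofibrant z"
  obtains c i0 i1 \<sigma> where "i0 \<in> hom C z c" "i1 \<in> hom C z c" "\<sigma> \<in> hom C c z"
    "\<sigma> \<cdot> i0 = Ide C z" "\<sigma> \<cdot> i1 = Ide C z" "i0 \<in> Cofib \<inter> Weq"
    "\<And>p v w k l b. \<lbrakk>p \<in> hom C v w; p \<in> Fib \<inter> Weq; k \<in> hom C z v; l \<in> hom C z v; b \<in> hom C c w;
      p \<cdot> k = b \<cdot> i0; p \<cdot> l = b \<cdot> i1\<rbrakk> \<Longrightarrow> \<exists>h\<in>hom C c v. h \<cdot> i0 = k \<and> h \<cdot> i1 = l \<and> p \<cdot> h = b"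
proof -
  have zo: "z \<in> Obj C" by (rule cofibrant_obj[OF z])
  obtain s \<iota> where s: "is_coproduct C {0, 1::nat} (\<lambda>_. z) s \<iota>"
    using finite_coproducts zo unfolding has_finite_coproducts_def has_coproducts_def by force
  define \<iota>0 \<iota>1 where "\<iota>0 = \<iota> 0" and "\<iota>1 = \<iota> 1"
  have \<iota>: "\<iota>0 \<in> hom C z s" "\<iota>1 \<in> hom C z s"
    using s by (auto simp: is_coproduct_def \<iota>0_def \<iota>1_def)
  have copair: "\<exists>h. h \<in> hom C s v \<and> h \<cdot> \<iota>0 = k \<and> h \<cdot> \<iota>1 = l"
    if kl: "k \<in> hom C z v" "l \<in> hom C z v" for k l v
  proof -
    obtain h where h: "h \<in> hom C s v"
      "\<And>i. i \<in> {0, 1::nat} \<Longrightarrow> h \<cdot> \<iota> i = (if i = 0 then k else l)"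
      by (rule coproduct_ex[OF s hom_objs(2)[OF kl(1)], of "\<lambda>i. if i = 0 then k else l"])
        (use kl in auto)
    show ?thesis using h(1) h(2)[of 0] h(2)[of 1] by (auto simp: \<iota>0_def \<iota>1_def)
  qed
  have copair_eq: "h = h'"
    if "h \<in> hom C s v" "h' \<in> hom C s v" "h \<cdot> \<iota>0 = h' \<cdot> \<iota>0" "h \<cdot> \<iota>1 = h' \<cdot> \<iota>1" for h h' v
    using coproduct_eqI[OF s that(1,2)] that(3,4) by (auto simp: \<iota>0_def \<iota>1_def)
  obtain n where n: "n \<in> hom C s z" "n \<cdot> \<iota>0 = Ide C z" "n \<cdot> \<iota>1 = Ide C z"
    using copair ide_hom[OF zo] by blast
  obtain c j \<sigma> where j: "j \<in> hom C s c" "j \<in> Cofib" and \<sigma>: "\<sigma> \<in> hom C c z" "\<sigma> \<in> Fib \<inter> Weq"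
    and n_eq: "n = \<sigma> \<cdot> j"
    using n(1) by (rule factor_cofib)
  have i0: "j \<cdot> \<iota>0 \<in> hom C z c" and i1: "j \<cdot> \<iota>1 \<in> hom C z c" using j \<iota> by auto
  have \<sigma>i: "\<sigma> \<cdot> (j \<cdot> \<iota>0) = Ide C z" "\<sigma> \<cdot> (j \<cdot> \<iota>1) = Ide C z"
    using comp_assoc[OF \<iota>(1) j(1) \<sigma>(1)] comp_assoc[OF \<iota>(2) j(1) \<sigma>(1)] n n_eq by auto
  have "\<iota>0 \<in> Cofib"
  proof (rule cofib_if_lifting[OF \<iota>(1)])
    fix p v w a b
    assume p: "p \<in> hom C v w" "p \<in> Fib \<inter> Weq" and a: "a \<in> hom C z v" and b: "b \<in> hom C s w"
      and sq: "p \<cdot> a = b \<cdot> \<iota>0"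
    obtain a' where a': "a' \<in> hom C z v" "p \<cdot> a' = b \<cdot> \<iota>1"
      using cofibrantD[OF z p comp_hom[OF \<iota>(2) b]] .
    obtain h where h: "h \<in> hom C s v" "h \<cdot> \<iota>0 = a" "h \<cdot> \<iota>1 = a'"
      using copair a a' by blast
    have "p \<cdot> h = b"
      using comp_assoc[OF \<iota>(1) h(1) p(1)] comp_assoc[OF \<iota>(2) h(1) p(1)] h sq a'
      by (intro copair_eq[OF comp_hom[OF h(1) p(1)] b]) auto
    then show "\<exists>h\<in>hom C s v. h \<cdot> \<iota>0 = a \<and> p \<cdot> h = b" using h by blast
  qed
  then have "j \<cdot> \<iota>0 \<in> Cofib" using cofib_comp[OF \<iota>(1) j(1)] j by blast
  moreover have "j \<cdot> \<iota>0 \<in> Weq"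
    using weq_cancel_left[OF i0 \<sigma>(1)] \<sigma> ide_class[OF zo] \<sigma>i by simp
  moreover have "\<exists>h\<in>hom C c v. h \<cdot> (j \<cdot> \<iota>0) = k \<and> h \<cdot> (j \<cdot> \<iota>1) = l \<and> p \<cdot> h = b"
    if p: "p \<in> hom C v w" "p \<in> Fib \<inter> Weq" and k: "k \<in> hom C z v" and l: "l \<in> hom C z v"
      and b: "b \<in> hom C c w" and sq: "p \<cdot> k = b \<cdot> (j \<cdot> \<iota>0)" "p \<cdot> l = b \<cdot> (j \<cdot> \<iota>1)" for p v w k l b
  proof -
    obtain m where m: "m \<in> hom C s v" "m \<cdot> \<iota>0 = k" "m \<cdot> \<iota>1 = l" using copair k l by blast
    have "p \<cdot> m = b \<cdot> j"
      using comp_assoc[OF \<iota>(1) m(1) p(1)] comp_assoc[OF \<iota>(2) m(1) p(1)]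
        comp_assoc[OF \<iota>(1) j(1) b] comp_assoc[OF \<iota>(2) j(1) b] m sq
      by (intro copair_eq[OF comp_hom[OF m(1) p(1)] comp_hom[OF j(1) b]]) auto
    then obtain h where h: "h \<in> hom C c v" "h \<cdot> j = m" "p \<cdot> h = b"
      using lift_cofib[OF j(1) p(1) j(2) p(2) m(1) b] by blast
    then show ?thesis
      using comp_assoc[OF \<iota>(1) j(1) h(1)] comp_assoc[OF \<iota>(2) j(1) h(1)] m by auto
  qed
  ultimately show ?thesis using that[OF i0 i1 \<sigma>(1) \<sigma>i] by blast
qed

end

context model_category
begin

interpretation op: model_category "op_cat C" Fib Cofib Weq
  by (rule model_category_op_cat)

lemma op_cofibrant: "op.cofibrant y \<longleftrightarrow> fibrant y"
  by (simp add: op.cofibrant_def fibrant_def)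

lemma fibrant_replacement:
  assumes "x \<in> Obj C"
  obtains y r where "fibrant y" "r \<in> hom C x y" "r \<in> Cofib \<inter> Weq"
  using op.cofibrant_replacement[of x] assms by (auto simp: op_cofibrant)

text \<open>The dual of a cylinder.\<close>

lemma path_object:
  assumes "fibrant y"
  obtains P p0 p1 s where "p0 \<in> hom C P y" "p1 \<in> hom C P y" "s \<in> hom C y P"
    "p0 \<cdot> s = Ide C y" "p1 \<cdot> s = Ide C y" "p0 \<in> Fib \<inter> Weq"
    "\<And>i v w k l b. \<lbrakk>i \<in> hom C w v; i \<in> Cofib \<inter> Weq; k \<in> hom C v y; l \<in> hom C v y; b \<in> hom C w P;
      k \<cdot> i = p0 \<cdot> b; l \<cdot> i = p1 \<cdot> b\<rbrakk> \<Longrightarrow> \<exists>h\<in>hom C v P. p0 \<cdot> h = k \<and> p1 \<cdot> h = l \<and> h \<cdot> i = b"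
proof (rule op.cylinder[of y])
  show "op.cofibrant y" using assms by (simp add: op_cofibrant)
qed (use that in auto)

end


section \<open>Calculating with paths in the localization\<close>

context category
begin

lemma gz_append_right: "gz_eq C W x y p q \<Longrightarrow> path C W y r z \<Longrightarrow> gz_eq C W x z (p @ r) (q @ r)"
  by (rule gz_append[OF _ gz_refl])

lemma gz_append_left: "path C W x r y \<Longrightarrow> gz_eq C W y z p q \<Longrightarrow> gz_eq C W x z (r @ p) (r @ q)"
  by (rule gz_append[OF gz_refl])

lemma path_Fwd: "f \<in> hom C x y \<Longrightarrow> path C W y p z \<Longrightarrow> path C W x (Fwd f # p) z"
  by (auto simp: hom_iff)

lemma path_Bwd: "w \<in> hom C x y \<Longrightarrow> w \<in> W \<Longrightarrow> path C W x p z \<Longrightarrow> path C W y (Bwd w # p) z"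
  by (auto simp: hom_iff)

lemma path_Nil: "x \<in> Obj C \<Longrightarrow> path C W x [] x"
  by simp

lemma gz_Fwd:
  assumes "f \<in> hom C x y" "gz_eq C W y z p q" shows "gz_eq C W x z (Fwd f # p) (Fwd f # q)"
  using gz_append_left[OF path_Fwd[OF assms(1) path_Nil] assms(2)] hom_objs[OF assms(1)] by simp

lemma gz_Bwd:
  assumes "w \<in> hom C x y" "w \<in> W" "gz_eq C W x z p q"
  shows "gz_eq C W y z (Bwd w # p) (Bwd w # q)"
  using gz_append_left[OF path_Bwd[OF assms(1,2) path_Nil] assms(3)] hom_objs[OF assms(1)] by simp

lemma gz_comp_Cons:
  assumes "f \<in> hom C x y" "g \<in> hom C y z" "path C W z p v"
  shows "gz_eq C W x v (Fwd f # Fwd g # p) (Fwd (g \<cdot> f) # p)"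
  using gz_append_right[OF gz_comp[OF assms(1,2)] assms(3)] by simp

lemma gz_ide_Cons:
  assumes "path C W x p v" shows "gz_eq C W x v (Fwd (Ide C x) # p) p"
  using gz_append_right[OF gz_ide assms] path_objs[OF assms] by simp

lemma gz_inv_right_Cons:
  assumes "w \<in> hom C x y" "w \<in> W" "path C W x p v"
  shows "gz_eq C W x v (Fwd w # Bwd w # p) p"
  using gz_append_right[OF gz_inv_right[OF assms(2,1)] assms(3)] by simp

lemma gz_inv_left_Cons:
  assumes "w \<in> hom C x y" "w \<in> W" "path C W y p v"
  shows "gz_eq C W y v (Bwd w # Fwd w # p) p"
  using gz_append_right[OF gz_inv_left[OF assms(2,1)] assms(3)] by simp

text \<open>
  A commutative square with weak equivalences \<open>q\<close>, \<open>q'\<close> lets a formal inverse move past an arrow.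
\<close>

lemma gz_square:
  assumes q: "q \<in> hom C z x" "q \<in> W" and q': "q' \<in> hom C z' x'" "q' \<in> W"
    and g: "g \<in> hom C z z'" and f: "f \<in> hom C x x'" and sq: "q' \<cdot> g = f \<cdot> q"
    and p: "path C W z' p v"
  shows "gz_eq C W x v (Bwd q # Fwd g # p) (Fwd f # Bwd q' # p)"
proof -
  have p': "path C W x' (Bwd q' # p) v" by (rule path_Bwd[OF q' p])
  have "gz_eq C W z v (Fwd g # p) (Fwd g # Fwd q' # Bwd q' # p)"
    by (rule gz_Fwd[OF g gz_sym[OF gz_inv_right_Cons[OF q' p]]])
  moreover have "gz_eq C W z v (Fwd g # Fwd q' # Bwd q' # p) (Fwd (f \<cdot> q) # Bwd q' # p)"
    using gz_comp_Cons[OF g q'(1) p'] sq by simp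
  moreover have "gz_eq C W z v (Fwd (f \<cdot> q) # Bwd q' # p) (Fwd q # Fwd f # Bwd q' # p)"
    by (rule gz_sym[OF gz_comp_Cons[OF q(1) f p']])
  ultimately have "gz_eq C W z v (Fwd g # p) (Fwd q # Fwd f # Bwd q' # p)"
    by (blast intro: gz_trans)
  then have "gz_eq C W x v (Bwd q # Fwd g # p) (Bwd q # Fwd q # Fwd f # Bwd q' # p)"
    by (rule gz_Bwd[OF q])
  then show ?thesis using gz_inv_left_Cons[OF q path_Fwd[OF f p']] by (rule gz_trans)
qed

end


section \<open>Right homotopy\<close>

text \<open>
  A fibrant object with a fixed path object.  Fixing it matters for coproducts: homotopies
  on the summands can only be assembled if all of them have the same target.
\<close>

locale path_object = model_category C Cofib Fib Weq
  for C :: "('o, 'm) cat" (structure) and Cofib Fib Weq :: "'m set" +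
  fixes y P :: 'o and p0 p1 s :: 'm
  assumes fibrant_y: "fibrant y"
    and p0: "p0 \<in> hom C P y" and p1: "p1 \<in> hom C P y" and s: "s \<in> hom C y P"
    and p0_s: "p0 \<cdot> s = Ide C y" and p1_s: "p1 \<cdot> s = Ide C y"
    and p0_tfib: "p0 \<in> Fib \<inter> Weq"
    and path_lift: "\<lbrakk>i \<in> hom C w v; i \<in> Cofib \<inter> Weq; k \<in> hom C v y; l \<in> hom C v y; b \<in> hom C w P;
      k \<cdot> i = p0 \<cdot> b; l \<cdot> i = p1 \<cdot> b\<rbrakk> \<Longrightarrow> \<exists>h\<in>hom C v P. p0 \<cdot> h = k \<and> p1 \<cdot> h = l \<and> h \<cdot> i = b"
begin

definition homotopic :: "'m \<Rightarrow> 'm \<Rightarrow> bool" (infix "\<simeq>" 50) where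
  "a \<simeq> b \<longleftrightarrow> (\<exists>H\<in>hom C (Dom C a) P. p0 \<cdot> H = a \<and> p1 \<cdot> H = b)"

lemma homotopicI: "H \<in> hom C z P \<Longrightarrow> p0 \<cdot> H = a \<Longrightarrow> p1 \<cdot> H = b \<Longrightarrow> a \<simeq> b"
  using comp_hom[OF _ p0, of H z] unfolding homotopic_def by (auto simp: hom_iff)

lemma homotopicE:
  assumes "a \<simeq> b" "a \<in> hom C z y"
  obtains H where "H \<in> hom C z P" "p0 \<cdot> H = a" "p1 \<cdot> H = b"
  using assms unfolding homotopic_def by (auto simp: hom_iff)

lemma homotopic_hom: "a \<simeq> b \<Longrightarrow> a \<in> hom C z y \<Longrightarrow> b \<in> hom C z y"
  using p1 by (metis homotopicE comp_hom)

lemma homotopic_refl: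
  assumes "a \<in> hom C z y" shows "a \<simeq> a"
proof (rule homotopicI)
  show "s \<cdot> a \<in> hom C z P" using assms s by blast
  show "p0 \<cdot> (s \<cdot> a) = a" "p1 \<cdot> (s \<cdot> a) = a"
    using comp_assoc[OF assms s p0] comp_assoc[OF assms s p1] p0_s p1_s ide_left[OF assms] by simp_all
qed

lemma homotopic_comp:
  assumes "a \<simeq> b" "a \<in> hom C z y" "g \<in> hom C v z" shows "a \<cdot> g \<simeq> b \<cdot> g"
proof -
  obtain H where H: "H \<in> hom C z P" "p0 \<cdot> H = a" "p1 \<cdot> H = b" using assms(1,2) by (rule homotopicE)
  show ?thesis
  proof (rule homotopicI)
    show "H \<cdot> g \<in> hom C v P" using H assms(3) by blast
    show "p0 \<cdot> (H \<cdot> g) = a \<cdot> g" "p1 \<cdot> (H \<cdot> g) = b \<cdot> g"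
      using comp_assoc[OF assms(3) H(1) p0] comp_assoc[OF assms(3) H(1) p1] H by simp_all
  qed
qed

text \<open>
  On a cylinder of \<open>z\<close>, lift against \<open>p\<close> to get a left homotopy \<open>K\<close> from \<open>k\<close> to \<open>l\<close>.  The left
  homotopy \<open>b \<cdot> K\<close> is turned into a right homotopy by extending the constant homotopy at
  \<open>b \<cdot> k\<close> along the trivial cofibration \<open>i0\<close> to the whole cylinder, with \<open>b \<cdot> k \<cdot> \<sigma>\<close> and
  \<open>b \<cdot> K\<close> as endpoints, and restricting along \<open>i1\<close>.
\<close>

lemma homotopic_if_equal_along_tfib:
  assumes z: "cofibrant z" and p: "p \<in> hom C v w" "p \<in> Fib \<inter> Weq"
    and k: "k \<in> hom C z v" and l: "l \<in> hom C z v" and pkl: "p \<cdot> k = p \<cdot> l" and b: "b \<in> hom C v y"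
  shows "b \<cdot> k \<simeq> b \<cdot> l"
proof (rule cylinder[OF z])
  fix c i0 i1 \<sigma>
  assume i0: "i0 \<in> hom C z c" and i1: "i1 \<in> hom C z c" and \<sigma>: "\<sigma> \<in> hom C c z"
    and \<sigma>0: "\<sigma> \<cdot> i0 = Ide C z" and \<sigma>1: "\<sigma> \<cdot> i1 = Ide C z" and i0_tcof: "i0 \<in> Cofib \<inter> Weq"
    and lift: "\<And>p v w k l b. \<lbrakk>p \<in> hom C v w; p \<in> Fib \<inter> Weq; k \<in> hom C z v; l \<in> hom C z v; b \<in> hom C c w;
      p \<cdot> k = b \<cdot> i0; p \<cdot> l = b \<cdot> i1\<rbrakk> \<Longrightarrow> \<exists>h\<in>hom C c v. h \<cdot> i0 = k \<and> h \<cdot> i1 = l \<and> p \<cdot> h = b"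
  have const: "(m \<cdot> \<sigma>) \<cdot> i0 = m" "(m \<cdot> \<sigma>) \<cdot> i1 = m" if "m \<in> hom C z u" for m u
    using comp_assoc[OF i0 \<sigma> that] comp_assoc[OF i1 \<sigma> that] \<sigma>0 \<sigma>1 ide_right[OF that] by simp_all
  have pk: "p \<cdot> k \<in> hom C z w" using k p by blast
  \<comment> \<open>the left homotopy \<open>K\<close>, covering the constant homotopy at \<open>p \<cdot> k = p \<cdot> l\<close>\<close>
  have "\<exists>h\<in>hom C c v. h \<cdot> i0 = k \<and> h \<cdot> i1 = l \<and> p \<cdot> h = (p \<cdot> k) \<cdot> \<sigma>"
    by (rule lift[OF p k l comp_hom[OF \<sigma> pk]]) (simp_all only: const[OF pk] pkl[symmetric])
  then obtain K where K: "K \<in> hom C c v" "K \<cdot> i0 = k" "K \<cdot> i1 = l" by blast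
  define m where "m = b \<cdot> k"
  have m: "m \<in> hom C z y" using b k by (auto simp: m_def)
  have bK: "b \<cdot> K \<in> hom C c y" using b K by blast
  have ms: "m \<cdot> \<sigma> \<in> hom C c y" using m \<sigma> by blast
  have sm: "s \<cdot> m \<in> hom C z P" using m s by blast
  have ends: "p0 \<cdot> (s \<cdot> m) = m" "p1 \<cdot> (s \<cdot> m) = m"
    using comp_assoc[OF m s p0] comp_assoc[OF m s p1] p0_s p1_s ide_left[OF m] by simp_all
  have bKi: "(b \<cdot> K) \<cdot> i0 = m" "(b \<cdot> K) \<cdot> i1 = b \<cdot> l"
    using comp_assoc[OF i0 K(1) b] comp_assoc[OF i1 K(1) b] K by (simp_all add: m_def)
  have "\<exists>h\<in>hom C c P. p0 \<cdot> h = m \<cdot> \<sigma> \<and> p1 \<cdot> h = b \<cdot> K \<and> h \<cdot> i0 = s \<cdot> m"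
    by (rule path_lift[OF i0 i0_tcof ms bK sm]) (simp_all only: const[OF m] bKi ends)
  then obtain L where L: "L \<in> hom C c P" "p0 \<cdot> L = m \<cdot> \<sigma>" "p1 \<cdot> L = b \<cdot> K" by blast
  show ?thesis
  proof (rule homotopicI)
    show "L \<cdot> i1 \<in> hom C z P" using L i1 by blast
    show "p0 \<cdot> (L \<cdot> i1) = b \<cdot> k" "p1 \<cdot> (L \<cdot> i1) = b \<cdot> l"
      using comp_assoc[OF i1 L(1) p0] comp_assoc[OF i1 L(1) p1] L const[OF m] bKi
      by (simp_all add: m_def)
  qed
qed

text \<open>
  Homotopies \<open>H\<close> and \<open>K\<close> that start at the same arrow agree after \<open>p0\<close>, a trivial fibration, so
  their ends \<open>p1 \<cdot> H\<close> and \<open>p1 \<cdot> K\<close> are homotopic.  Together with reflexivity this yields symmetry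
  and transitivity without gluing homotopies.
\<close>

lemma homotopic_euclidean:
  assumes "cofibrant z" "a \<in> hom C z y" "a \<simeq> b" "a \<simeq> c" shows "b \<simeq> c"
proof -
  obtain H where "H \<in> hom C z P" "p0 \<cdot> H = a" "p1 \<cdot> H = b" using assms(3,2) by (rule homotopicE)
  moreover obtain K where "K \<in> hom C z P" "p0 \<cdot> K = a" "p1 \<cdot> K = c" using assms(4,2) by (rule homotopicE)
  ultimately show ?thesis
    using homotopic_if_equal_along_tfib[OF assms(1) p0 p0_tfib _ _ _ p1, of H K] by simp
qed

lemma homotopic_sym: "cofibrant z \<Longrightarrow> a \<in> hom C z y \<Longrightarrow> a \<simeq> b \<Longrightarrow> b \<simeq> a"
  using homotopic_euclidean homotopic_refl by blast

lemma homotopic_trans: "cofibrant z \<Longrightarrow> a \<in> hom C z y \<Longrightarrow> a \<simeq> b \<Longrightarrow> b \<simeq> c \<Longrightarrow> a \<simeq> c"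
  using homotopic_euclidean homotopic_sym homotopic_hom by blast

text \<open>
  A weak equivalence \<open>g\<close> between cofibrant objects induces a bijection on homotopy classes of
  arrows into \<open>y\<close>.  This is clear for trivial cofibrations, by extension of arrows and of
  homotopies, and for trivial fibrations onto a cofibrant object, which have a
  section, inverse to them up to homotopy by \<open>homotopic_if_equal_along_tfib\<close>; \<open>g\<close> is a
  composite of these.  Surjectivity is \<open>extend_along_weq\<close>, injectivity is
  \<open>homotopic_cancel_weq\<close>.
\<close>

lemma factor_weq_section:
  assumes z': "cofibrant z'" and g: "g \<in> hom C z z'" "g \<in> Weq"
  obtains u i p t where "i \<in> hom C z u" "i \<in> Cofib \<inter> Weq" "p \<in> hom C u z'" "p \<in> Fib \<inter> Weq"
    "g = p \<cdot> i" "t \<in> hom C z' u" "p \<cdot> t = Ide C z'"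
proof -
  obtain u i p where i: "i \<in> hom C z u" "i \<in> Cofib" and p: "p \<in> hom C u z'" "p \<in> Fib \<inter> Weq"
    and gpi: "g = p \<cdot> i" using g(1) by (rule factor_cofib)
  have "i \<in> Weq" using weq_cancel_left[OF i(1) p(1)] p g gpi by simp
  moreover obtain t where "t \<in> hom C z' u" "p \<cdot> t = Ide C z'"
    using cofibrantD[OF z' p ide_hom[OF cofibrant_obj[OF z']]] .
  ultimately show ?thesis using that i p gpi by blast
qed

lemma extend_along_weq:
  assumes z: "cofibrant z" and z': "cofibrant z'" and g: "g \<in> hom C z z'" "g \<in> Weq" and a: "a \<in> hom C z y"
  obtains a' where "a' \<in> hom C z' y" "a \<simeq> a' \<cdot> g"
proof -
  obtain u i p t where i: "i \<in> hom C z u" "i \<in> Cofib \<inter> Weq" and p: "p \<in> hom C u z'" "p \<in> Fib \<inter> Weq"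
    and gpi: "g = p \<cdot> i" and t: "t \<in> hom C z' u" "p \<cdot> t = Ide C z'"
    using z' g by (rule factor_weq_section)
  obtain b where b: "b \<in> hom C u y" "b \<cdot> i = a" using fibrantD[OF fibrant_y i a] .
  have tg: "t \<cdot> g \<in> hom C z u" using t g by blast
  have "p \<cdot> i = p \<cdot> (t \<cdot> g)"
    using comp_assoc[OF g(1) t(1) p(1)] t ide_left[OF g(1)] gpi by simp
  then have "b \<cdot> i \<simeq> b \<cdot> (t \<cdot> g)" by (rule homotopic_if_equal_along_tfib[OF z p i(1) tg _ b(1)])
  then have "a \<simeq> (b \<cdot> t) \<cdot> g" using b comp_assoc[OF g(1) t(1) b(1)] by simp
  then show ?thesis using that t b by blast
qed

lemma homotopic_cancel_weq:
  assumes z': "cofibrant z'" and g: "g \<in> hom C z z'" "g \<in> Weq"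
    and a: "a \<in> hom C z' y" and b: "b \<in> hom C z' y" and ab: "a \<cdot> g \<simeq> b \<cdot> g"
  shows "a \<simeq> b"
proof -
  obtain u i p t where i: "i \<in> hom C z u" "i \<in> Cofib \<inter> Weq" and p: "p \<in> hom C u z'" "p \<in> Fib \<inter> Weq"
    and gpi: "g = p \<cdot> i" and t: "t \<in> hom C z' u" "p \<cdot> t = Ide C z'"
    using z' g by (rule factor_weq_section)
  obtain H where H: "H \<in> hom C z P" "p0 \<cdot> H = a \<cdot> g" "p1 \<cdot> H = b \<cdot> g"
    using homotopicE[OF ab comp_hom[OF g(1) a]] .
  have ap: "a \<cdot> p \<in> hom C u y" and bp: "b \<cdot> p \<in> hom C u y" using a b p by auto
  have "\<exists>h\<in>hom C u P. p0 \<cdot> h = a \<cdot> p \<and> p1 \<cdot> h = b \<cdot> p \<and> h \<cdot> i = H"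
    by (rule path_lift[OF i ap bp H(1)])
      (simp_all only: comp_assoc[OF i(1) p(1) a] comp_assoc[OF i(1) p(1) b] H gpi)
  then obtain L where L: "L \<in> hom C u P" "p0 \<cdot> L = a \<cdot> p" "p1 \<cdot> L = b \<cdot> p" by blast
  show ?thesis
  proof (rule homotopicI)
    show "L \<cdot> t \<in> hom C z' P" using L t by blast
    show "p0 \<cdot> (L \<cdot> t) = a" "p1 \<cdot> (L \<cdot> t) = b"
      using comp_assoc[OF t(1) L(1) p0] comp_assoc[OF t(1) L(1) p1] L t
        comp_assoc[OF t(1) p(1) a] comp_assoc[OF t(1) p(1) b] ide_right[OF a] ide_right[OF b] by simp_all
  qed
qed

text \<open>
  Both \<open>p0\<close> and \<open>p1\<close> are left inverse to \<open>s\<close>, and \<open>s\<close> becomes invertible since \<open>p0\<close> does; so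
  \<open>p0\<close> and \<open>p1\<close> have the same image in the localization.
\<close>

lemma gz_if_homotopic:
  assumes "a \<simeq> b" "a \<in> hom C z y"
  shows "gz_eq C Weq z y [Fwd a] [Fwd b]"
proof -
  obtain H where H: "H \<in> hom C z P" "p0 \<cdot> H = a" "p1 \<cdot> H = b" using assms by (rule homotopicE)
  have yo: "y \<in> Obj C" using hom_objs p0 by blast
  have weq: "p0 \<in> Weq" using p0_tfib by blast
  note nil = path_Nil[OF yo]
  have eq: "gz_eq C Weq y y [Fwd s, Fwd p] []" if "p \<in> hom C P y" "p \<cdot> s = Ide C y" for p
    using gz_trans[OF gz_comp_Cons[OF s that(1) nil]] gz_ide_Cons[OF nil] that(2) by simp
  \<comment> \<open>a right inverse of the invertible \<open>p0\<close> is also a left inverse\<close>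
  have inv: "gz_eq C Weq P P [Fwd p0, Fwd s] []"
  proof -
    have Po: "P \<in> Obj C" using hom_objs p0 by blast
    have "gz_eq C Weq P P [Fwd p0, Fwd s] [Fwd p0, Fwd s, Fwd p0, Bwd p0]"
      using gz_append_left[OF path_Fwd[OF p0 path_Fwd[OF s path_Nil[OF Po]]]
          gz_sym[OF gz_inv_right_Cons[OF p0 weq path_Nil[OF Po]]]] by simp
    moreover have "gz_eq C Weq P P [Fwd p0, Fwd s, Fwd p0, Bwd p0] [Fwd p0, Bwd p0]"
      using gz_Fwd[OF p0 gz_append_right[OF eq[OF p0 p0_s] path_Bwd[OF p0 weq path_Nil[OF Po]]]] by simp
    ultimately show ?thesis
      using gz_inv_right_Cons[OF p0 weq path_Nil[OF Po]] by (blast intro: gz_trans)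
  qed
  have "gz_eq C Weq P y [Fwd p1] [Fwd p0, Fwd s, Fwd p1]"
    using gz_append_right[OF gz_sym[OF inv] path_Fwd[OF p1 nil]] by simp
  moreover have "gz_eq C Weq P y [Fwd p0, Fwd s, Fwd p1] [Fwd p0]"
    using gz_Fwd[OF p0 eq[OF p1 p1_s]] .
  ultimately have "gz_eq C Weq z y [Fwd H, Fwd p0] [Fwd H, Fwd p1]"
    using gz_Fwd[OF H(1)] by (blast intro: gz_sym gz_trans)
  then show ?thesis
    using gz_comp_Cons[OF H(1) p0 nil] gz_comp_Cons[OF H(1) p1 nil] H gz_sym gz_trans by metis
qed


section \<open>Transport of homotopy classes along paths\<close>

definition resolution :: "'o \<Rightarrow> 'm \<Rightarrow> 'o \<Rightarrow> bool" where
  "resolution z q x \<longleftrightarrow> cofibrant z \<and> q \<in> hom C z x \<and> q \<in> Fib \<inter> Weq"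

lemma resolutionD:
  assumes "resolution z q x"
  shows "cofibrant z" "q \<in> hom C z x" "q \<in> Fib \<inter> Weq" "q \<in> Weq"
  using assms by (auto simp: resolution_def)

lemma resolution_exists:
  assumes "x \<in> Obj C" obtains z q where "resolution z q x"
  using cofibrant_replacement[OF assms] unfolding resolution_def by metis

lemma resolution_lift:
  assumes "resolution z q x" "resolution z' q' x'" "f \<in> hom C x x'"
  obtains g where "g \<in> hom C z z'" "q' \<cdot> g = f \<cdot> q"
  using cofibrantD[of z q' z' x' "f \<cdot> q"] assms resolutionD comp_hom by metis

text \<open>
  An element of the presheaf at \<open>x\<close> is given by an arrow to \<open>y\<close> out of any resolution of \<open>x\<close>.
  Keeping the resolution as part of the element avoids choosing one for each object.
\<close>

definition element :: "'o \<Rightarrow> 'm \<times> 'm \<Rightarrow> bool" where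
  "element x e \<longleftrightarrow> (\<exists>z. resolution z (fst e) x \<and> snd e \<in> hom C z y)"

text \<open>
  The graph of the action of \<open>f\<close>, contravariant as for a presheaf: \<open>transport f e' e\<close> says that
  \<open>e\<close> over the domain of \<open>f\<close> is the restriction of \<open>e'\<close> over its codomain.  Transport along an
  identity is the relation of representing the same element of the presheaf.
\<close>

inductive transport :: "'m \<Rightarrow> 'm \<times> 'm \<Rightarrow> 'm \<times> 'm \<Rightarrow> bool" where
  transportI: "\<lbrakk>f \<in> hom C x x'; resolution z q x; a \<in> hom C z y; resolution z' q' x'; a' \<in> hom C z' y;
     g \<in> hom C z z'; q' \<cdot> g = f \<cdot> q; a \<simeq> a' \<cdot> g\<rbrakk> \<Longrightarrow> transport f (q', a') (q, a)"

lemma transportE: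
  assumes "transport f e' e" "f \<in> hom C x x'"
  obtains z z' q a q' a' g where "e = (q, a)" "e' = (q', a')"
    "resolution z q x" "a \<in> hom C z y" "resolution z' q' x'" "a' \<in> hom C z' y"
    "g \<in> hom C z z'" "q' \<cdot> g = f \<cdot> q" "a \<simeq> a' \<cdot> g"
  using assms(1)
proof cases
  case (transportI x1 x1' z q a z' q' a' g)
  moreover have "x1 = x" "x1' = x'" using assms(2) transportI(3) by (auto simp: hom_iff)
  ultimately show ?thesis using that by blast
qed

text \<open>
  Two lifts of \<open>f\<close> to resolutions agree after the trivial fibration \<open>q'\<close>; hence the choice of lift
  does not matter up to homotopy.
\<close>

lemma transport_any_lift:
  assumes "transport f (q', a') (q, a)" "f \<in> hom C x x'" "g \<in> hom C z z'"
    "q \<in> hom C z x" "q' \<in> hom C z' x'" "q' \<cdot> g = f \<cdot> q"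
  shows "a \<simeq> a' \<cdot> g"
  using assms(1,2)
proof (rule transportE)
  fix z1 z1' q1 a1 q1' a1' g1
  assume *: "(q, a) = (q1, a1)" "(q', a') = (q1', a1')" "resolution z1 q1 x" "a1 \<in> hom C z1 y"
    "resolution z1' q1' x'" "a1' \<in> hom C z1' y" "g1 \<in> hom C z1 z1'" "q1' \<cdot> g1 = f \<cdot> q1" "a1 \<simeq> a1' \<cdot> g1"
  then have z: "z1 = z" "z1' = z'" using assms(4,5) resolutionD(2) by (auto simp: hom_iff)
  have "a' \<cdot> g1 \<simeq> a' \<cdot> g"
    using homotopic_if_equal_along_tfib[OF resolutionD(1)[OF *(3)] resolutionD(2,3)[OF *(5)] *(7), of g a']
      * z assms by simp
  then show "a \<simeq> a' \<cdot> g"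
    using homotopic_trans[OF resolutionD(1)[OF *(3)] *(4)] * by simp
qed

lemma transport_total:
  assumes f: "f \<in> hom C x x'" and q: "resolution z q x" and q': "resolution z' q' x'"
    and a': "a' \<in> hom C z' y"
  obtains a where "a \<in> hom C z y" "transport f (q', a') (q, a)"
proof -
  obtain g where g: "g \<in> hom C z z'" "q' \<cdot> g = f \<cdot> q" using q q' f by (rule resolution_lift)
  have a: "a' \<cdot> g \<in> hom C z y" using a' g by blast
  show ?thesis using that[OF a] transportI[OF f q a q' a' g homotopic_refl[OF a]] .
qed

lemma transport_functional:
  assumes f: "f \<in> hom C x x'" and e: "transport f e' e1" "transport f e' e2"
  shows "transport (Ide C x) e1 e2"
  using e(1) f
proof (rule transportE)
  fix z1 z' q1 a1 q' a' g1
  assume 1: "e1 = (q1, a1)" "e' = (q', a')" "resolution z1 q1 x" "a1 \<in> hom C z1 y"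
    "resolution z' q' x'" "a' \<in> hom C z' y" "g1 \<in> hom C z1 z'" "q' \<cdot> g1 = f \<cdot> q1" "a1 \<simeq> a' \<cdot> g1"
  obtain z2 q2 a2 where 2: "e2 = (q2, a2)" "resolution z2 q2 x" "a2 \<in> hom C z2 y"
    using e(2) f by (rule transportE) blast
  note q1 = resolutionD[OF 1(3)] and q2 = resolutionD[OF 2(2)] and q' = resolutionD[OF 1(5)]
  have id: "Ide C x \<in> hom C x x" using ide_hom hom_objs f by blast
  obtain h where h: "h \<in> hom C z2 z1" "q1 \<cdot> h = Ide C x \<cdot> q2" using 2(2) 1(3) id by (rule resolution_lift)
  have gh: "g1 \<cdot> h \<in> hom C z2 z'" using h 1 by blast
  have "q' \<cdot> (g1 \<cdot> h) = f \<cdot> q2"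
    using comp_assoc[OF h(1) 1(7) q'(2)] comp_assoc[OF h(1) q1(2) f] 1 h ide_left[OF q2(2)] by simp
  then have "a2 \<simeq> a' \<cdot> (g1 \<cdot> h)"
    using transport_any_lift[OF _ f gh q2(2) q'(2)] e(2) 1 2 by simp
  moreover have "a1 \<cdot> h \<simeq> a' \<cdot> (g1 \<cdot> h)"
    using homotopic_comp[OF 1(9,4) h(1)] comp_assoc[OF h(1) 1(7,6)] by simp
  ultimately have "a2 \<simeq> a1 \<cdot> h"
    using homotopic_trans homotopic_sym q2(1) 2(3) comp_hom[OF h(1) 1(4)] by metis
  then show "transport (Ide C x) e1 e2"
    using transportI[OF id 2(2,3) 1(3,4) h] 1(1) 2(1) by simp
qed

lemma transport_element:
  assumes "transport f e' e" "f \<in> hom C x x'" shows "element x e" "element x' e'"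
  using assms by (auto elim!: transportE simp: element_def)

lemma transport_ide_refl:
  assumes "element x e" shows "transport (Ide C x) e e"
proof -
  obtain z q a where e: "e = (q, a)" "resolution z q x" "a \<in> hom C z y"
    using assms by (cases e) (auto simp: element_def)
  have xz: "x \<in> Obj C" "z \<in> Obj C" using hom_objs resolutionD(2)[OF e(2)] by auto
  then show ?thesis
    using transportI[OF ide_hom[OF xz(1)] e(2,3) e(2,3) ide_hom[OF xz(2)]] e(1)
      ide_left[OF resolutionD(2)[OF e(2)]] ide_right[OF resolutionD(2)[OF e(2)]]
      ide_right[OF e(3)] homotopic_refl[OF e(3)] by simp
qed

lemma transport_ide_sym:
  assumes x: "x \<in> Obj C" and e: "transport (Ide C x) e' e" shows "transport (Ide C x) e e'"
  by (rule transport_functional[OF ide_hom[OF x] e transport_ide_refl])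
    (rule transport_element(2)[OF e ide_hom[OF x]])

lemma transport_comp:
  assumes f: "f \<in> hom C x x'" and f': "f' \<in> hom C x' x''"
  shows "transport f' OO transport f = transport (f' \<cdot> f)"
proof (intro ext iffI)
  have ff: "f' \<cdot> f \<in> hom C x x''" using f f' by blast
  {
    fix e'' e assume "(transport f' OO transport f) e'' e"
    then obtain e' where e: "transport f e' e" and e': "transport f' e'' e'" by blast
    obtain z z' q a q' a' g where 1: "e = (q, a)" "e' = (q', a')"
      "resolution z q x" "a \<in> hom C z y" "resolution z' q' x'" "a' \<in> hom C z' y"
      "g \<in> hom C z z'" "q' \<cdot> g = f \<cdot> q" "a \<simeq> a' \<cdot> g"
      using e f by (rule transportE)
    obtain z2 z'' q2 a2 q'' a'' g' where "e' = (q2, a2)" and 2: "e'' = (q'', a'')"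
      "resolution z2 q2 x'" "resolution z'' q'' x''" "a'' \<in> hom C z'' y"
      "g' \<in> hom C z2 z''" "q'' \<cdot> g' = f' \<cdot> q2" "a2 \<simeq> a'' \<cdot> g'"
      using e' f' by (rule transportE)
    then have eq: "q2 = q'" "a2 = a'" using 1 by auto
    have "z2 = z'" using resolutionD(2)[OF 1(5)] resolutionD(2)[OF 2(2)] eq by (simp add: hom_iff)
    then have g': "g' \<in> hom C z' z''" and sq: "q'' \<cdot> g' = f' \<cdot> q'" and a': "a' \<simeq> a'' \<cdot> g'"
      using 2 eq by auto
    note q = resolutionD(2)[OF 1(3)] and q' = resolutionD(2)[OF 1(5)] and q'' = resolutionD(2)[OF 2(3)]
    have "q'' \<cdot> (g' \<cdot> g) = (f' \<cdot> f) \<cdot> q"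
      using comp_assoc[OF 1(7) g' q''] comp_assoc[OF 1(7) q' f'] comp_assoc[OF q f f'] sq 1(8) by simp
    moreover have "a' \<cdot> g \<simeq> a'' \<cdot> (g' \<cdot> g)"
      using homotopic_comp[OF a' 1(6,7)] comp_assoc[OF 1(7) g' 2(4)] by simp
    then have "a \<simeq> a'' \<cdot> (g' \<cdot> g)" using homotopic_trans[OF resolutionD(1)[OF 1(3)] 1(4,9)] by simp
    ultimately show "transport (f' \<cdot> f) e'' e"
      using transportI[OF ff 1(3,4) 2(3,4) comp_hom[OF 1(7) g']] 1(1) 2(1) by simp
  next
    fix e'' e assume e: "transport (f' \<cdot> f) e'' e"
    obtain z z'' q a q'' a'' where 1: "e = (q, a)" "e'' = (q'', a'')"
      "resolution z q x" "a \<in> hom C z y" "resolution z'' q'' x''" "a'' \<in> hom C z'' y"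
      using e ff by (rule transportE)
    obtain z' q' where q': "resolution z' q' x'"
      using resolution_exists[OF hom_objs(2)[OF f]] .
    obtain g where g: "g \<in> hom C z z'" "q' \<cdot> g = f \<cdot> q" using 1(3) q' f by (rule resolution_lift)
    obtain g' where g': "g' \<in> hom C z' z''" "q'' \<cdot> g' = f' \<cdot> q'" using q' 1(5) f' by (rule resolution_lift)
    have a': "a'' \<cdot> g' \<in> hom C z' y" using g' 1 by blast
    note q = resolutionD(2)[OF 1(3)] and q'h = resolutionD(2)[OF q'] and q'' = resolutionD(2)[OF 1(5)]
    have "q'' \<cdot> (g' \<cdot> g) = (f' \<cdot> f) \<cdot> q"
      using comp_assoc[OF g(1) g'(1) q''] comp_assoc[OF g(1) q'h f'] comp_assoc[OF q f f'] g g' by simp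
    then have "a \<simeq> a'' \<cdot> (g' \<cdot> g)"
      using transport_any_lift[OF _ ff comp_hom[OF g(1) g'(1)] q q''] e 1 by simp
    then have "a \<simeq> (a'' \<cdot> g') \<cdot> g" using comp_assoc[OF g(1) g'(1) 1(6)] by simp
    then have "transport f (q', a'' \<cdot> g') e"
      using transportI[OF f 1(3,4) q' a' g] 1(1) by simp
    moreover have "transport f' e'' (q', a'' \<cdot> g')"
      using transportI[OF f' q' a' 1(5,6) g' homotopic_refl[OF a']] 1(2) by simp
    ultimately show "(transport f' OO transport f) e'' e" by blast
  }
qed

text \<open>
  A lift of a weak equivalence to resolutions is a weak equivalence between cofibrant objects, so
  transport along it is bijective on homotopy classes.
\<close>

lemma transport_weq_total:
  assumes w: "w \<in> hom C x x'" "w \<in> Weq" and q: "resolution z q x" and q': "resolution z' q' x'"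
    and a: "a \<in> hom C z y"
  obtains a' where "a' \<in> hom C z' y" "transport w (q', a') (q, a)"
proof -
  obtain g where g: "g \<in> hom C z z'" "q' \<cdot> g = w \<cdot> q" using q q' w(1) by (rule resolution_lift)
  have "w \<cdot> q \<in> Weq" using weq_comp[OF resolutionD(2)[OF q] w(1)] resolutionD(4)[OF q] w(2) by blast
  then have "g \<in> Weq" using weq_cancel_left[OF g(1) resolutionD(2)[OF q']] resolutionD(4)[OF q'] g by simp
  then obtain a' where "a' \<in> hom C z' y" "a \<simeq> a' \<cdot> g"
    using extend_along_weq[OF resolutionD(1)[OF q] resolutionD(1)[OF q'] g(1) _ a] by blast
  then show ?thesis using that transportI[OF w(1) q a q' _ g] by blast
qed

lemma transport_weq_injective:
  assumes w: "w \<in> hom C x x'" "w \<in> Weq" and e: "transport w e1 e" "transport w e2 e"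
  shows "transport (Ide C x') e1 e2"
proof -
  obtain z z1 q a q1 a1 g1 where 1: "e = (q, a)" "e1 = (q1, a1)"
    "resolution z q x" "a \<in> hom C z y" "resolution z1 q1 x'" "a1 \<in> hom C z1 y"
    using e(1) w(1) by (rule transportE)
  obtain z0 z2 q0 a0 q2 a2 g2 where "e = (q0, a0)" and 2: "e2 = (q2, a2)"
    "resolution z0 q0 x" "resolution z2 q2 x'" "a2 \<in> hom C z2 y"
    "g2 \<in> hom C z0 z2" "q2 \<cdot> g2 = w \<cdot> q0" "a0 \<simeq> a2 \<cdot> g2"
    using e(2) w(1) by (rule transportE)
  then have eq: "q0 = q" "a0 = a" using 1 by auto
  note q = resolutionD[OF 1(3)] and q1 = resolutionD[OF 1(5)] and q2 = resolutionD[OF 2(3)]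
  have "z0 = z" using q(2) resolutionD(2)[OF 2(2)] eq by (simp add: hom_iff)
  then have g: "g2 \<in> hom C z z2" and sq: "q2 \<cdot> g2 = w \<cdot> q" and a: "a \<simeq> a2 \<cdot> g2" using 2 eq by auto
  have id: "Ide C x' \<in> hom C x' x'" using ide_hom hom_objs w by blast
  obtain h where h: "h \<in> hom C z2 z1" "q1 \<cdot> h = Ide C x' \<cdot> q2" using 2(3) 1(5) id by (rule resolution_lift)
  have "q1 \<cdot> (h \<cdot> g2) = w \<cdot> q" using comp_assoc[OF g h(1) q1(2)] h sq ide_left[OF q2(2)] by simp
  then have "a \<simeq> a1 \<cdot> (h \<cdot> g2)"
    using transport_any_lift[OF _ w(1) comp_hom[OF g h(1)] q(2) q1(2)] e(1) 1 by simp
  then have "a2 \<cdot> g2 \<simeq> (a1 \<cdot> h) \<cdot> g2"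
    using homotopic_euclidean[OF q(1) 1(4) a] comp_assoc[OF g h(1) 1(6)] by simp
  moreover have "g2 \<in> Weq"
    using weq_cancel_left[OF g q2(2,4)] weq_comp[OF q(2) w(1) q(4) w(2)] sq by simp
  ultimately have "a2 \<simeq> a1 \<cdot> h"
    using homotopic_cancel_weq[OF q2(1) g _ 2(4) comp_hom[OF h(1) 1(6)]] by blast
  then show ?thesis using transportI[OF id 2(3,4) 1(5,6) h] 1 2 by simp
qed

lemma transport_ide_right:
  assumes "f \<in> hom C x x'" shows "transport f OO transport (Ide C x) = transport f"
  using transport_comp[OF ide_hom assms] hom_objs(1)[OF assms] ide_right[OF assms] by simp

lemma transport_ide_left:
  assumes "f \<in> hom C x x'" shows "transport (Ide C x') OO transport f = transport f"
  using transport_comp[OF assms ide_hom] hom_objs(2)[OF assms] ide_left[OF assms] by simp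

lemma transport_ide_converse: "x \<in> Obj C \<Longrightarrow> (transport (Ide C x))\<inverse>\<inverse> = transport (Ide C x)"
  using transport_ide_sym by blast

lemma transport_weq_converse:
  assumes w: "w \<in> hom C x x'" "w \<in> Weq"
  shows "(transport w)\<inverse>\<inverse> OO transport w = transport (Ide C x)"
    and "transport w OO (transport w)\<inverse>\<inverse> = transport (Ide C x')"
proof -
  have x: "x \<in> Obj C" "x' \<in> Obj C" using hom_objs w by auto
  show "(transport w)\<inverse>\<inverse> OO transport w = transport (Ide C x)"
  proof (intro ext iffI)
    fix e1 e2 assume "((transport w)\<inverse>\<inverse> OO transport w) e1 e2"
    then show "transport (Ide C x) e1 e2" using transport_functional[OF w(1)] by blast
  next
    fix e1 e2 assume e: "transport (Ide C x) e1 e2"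
    obtain z q a where 1: "e1 = (q, a)" "resolution z q x" "a \<in> hom C z y"
      using e ide_hom[OF x(1)] by (rule transportE) blast
    obtain z' q' where q': "resolution z' q' x'"
      using resolution_exists[OF x(2)] .
    obtain a' where "transport w (q', a') e1" using transport_weq_total[OF w 1(2) q' 1(3)] 1(1) by blast
    moreover from this have "transport w (q', a') e2"
      using e transport_ide_right[OF w(1)] by (metis relcomppI)
    ultimately show "((transport w)\<inverse>\<inverse> OO transport w) e1 e2" by blast
  qed
  show "transport w OO (transport w)\<inverse>\<inverse> = transport (Ide C x')"
  proof (intro ext iffI)
    fix e1 e2 assume "(transport w OO (transport w)\<inverse>\<inverse>) e1 e2"
    then show "transport (Ide C x') e1 e2" using transport_weq_injective[OF w] by blast
  next
    fix e1 e2 assume e: "transport (Ide C x') e1 e2"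
    obtain z' q' a' where 1: "e1 = (q', a')" "resolution z' q' x'" "a' \<in> hom C z' y"
      using e ide_hom[OF x(2)] by (rule transportE) blast
    obtain z q where q: "resolution z q x"
      using resolution_exists[OF x(1)] .
    obtain a where a: "transport w e1 (q, a)" using transport_total[OF w(1) q 1(2,3)] 1(1) by blast
    moreover have "transport w e2 (q, a)"
      using a transport_ide_sym[OF x(2) e] transport_ide_left[OF w(1)] by (metis relcomppI)
    ultimately show "(transport w OO (transport w)\<inverse>\<inverse>) e1 e2" by blast
  qed
qed

text \<open>
  A formal inverse acts by the converse relation, so no inverse has to be chosen.
\<close>

fun path_transport :: "'o \<Rightarrow> 'm step list \<Rightarrow> 'm \<times> 'm \<Rightarrow> 'm \<times> 'm \<Rightarrow> bool" where
  "path_transport x [] = transport (Ide C x)"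
| "path_transport x (Fwd f # p) = path_transport (Cod C f) p OO transport f"
| "path_transport x (Bwd w # p) = path_transport (Dom C w) p OO (transport w)\<inverse>\<inverse>"

lemma path_transport_Fwd: "f \<in> hom C x x' \<Longrightarrow> path_transport v [Fwd f] = transport f"
  using transport_ide_left[of f x x'] by (auto simp: hom_iff)

lemma path_transport_ide_right:
  assumes "path C Weq x p x'" shows "path_transport x p OO transport (Ide C x) = path_transport x p"
proof (cases p)
  case Nil
  then show ?thesis using assms transport_ide_right[OF ide_hom] by auto
next
  case (Cons st p')
  show ?thesis
  proof (cases st)
    case (Fwd f)
    then have "f \<in> hom C x (Cod C f)" using assms Cons by (simp add: hom_iff)
    then show ?thesis using Fwd Cons transport_ide_right by (simp add: relcompp_assoc)
  next
    case (Bwd w)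
    then have w: "w \<in> hom C (Dom C w) x" using assms Cons by (simp add: hom_iff)
    have "(transport w)\<inverse>\<inverse> OO transport (Ide C x) = (transport (Ide C x) OO transport w)\<inverse>\<inverse>"
      using transport_ide_converse hom_objs(2)[OF w] by (simp add: converse_relcompp)
    also have "\<dots> = (transport w)\<inverse>\<inverse>" using transport_ide_left[OF w] by simp
    finally show ?thesis using Bwd Cons by (simp add: relcompp_assoc)
  qed
qed

lemma path_transport_append:
  assumes "path C Weq x p x'" "path C Weq x' q x''"
  shows "path_transport x (p @ q) = path_transport x' q OO path_transport x p"
  using assms(1)
proof (induction p arbitrary: x)
  case Nil
  then show ?case using path_transport_ide_right[OF assms(2)] by simp
next
  case (Cons st p)
  show ?case
  proof (cases st)
    case (Fwd f)
    then show ?thesis using Cons by (simp add: relcompp_assoc)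
  next
    case (Bwd w)
    then show ?thesis using Cons by (simp add: relcompp_assoc)
  qed
qed

text \<open>
  The presheaf descends to the localization: each generating relation of the localization is a
  property of transport already established, functoriality for arrows of the category and
  bijectivity for weak equivalences.
\<close>

lemma path_transport_gz_eq:
  assumes "gz_eq C Weq x x' p q" shows "path_transport x p = path_transport x q"
  using assms
proof (induction rule: gz_eq.induct)
  case (gz_append x x' p q x'' p' q')
  then show ?case
    using path_transport_append gz_eq_paths[OF gz_append(1)] gz_eq_paths[OF gz_append(2)] by metis
next
  case (gz_ide x)
  then show ?case using path_transport_Fwd[OF ide_hom] by simp
next
  case (gz_comp f x x' g x'')
  have "path_transport x [Fwd f, Fwd g] = path_transport x' [Fwd g] OO transport f"
    using gz_comp by (simp add: hom_iff)
  then show ?case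
    using path_transport_Fwd[OF gz_comp(2)] path_transport_Fwd[OF comp_hom[OF gz_comp]]
      transport_comp[OF gz_comp] by simp
next
  case (gz_inv_right w x x')
  have "transport (Ide C x) OO (transport w)\<inverse>\<inverse> = (transport w OO transport (Ide C x))\<inverse>\<inverse>"
    using transport_ide_converse hom_objs(1)[OF gz_inv_right(2)] by (simp add: converse_relcompp)
  then show ?case
    using gz_inv_right transport_ide_right[OF gz_inv_right(2)] transport_weq_converse[OF gz_inv_right(2,1)]
    by (simp add: hom_iff)
next
  case (gz_inv_left w x x')
  have "path_transport x' [Bwd w, Fwd w] = path_transport x [Fwd w] OO (transport w)\<inverse>\<inverse>"
    using gz_inv_left by (simp add: hom_iff)
  then show ?case
    using path_transport_Fwd[OF gz_inv_left(2)] transport_weq_converse[OF gz_inv_left(2,1)] by simp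
qed auto

lemma path_transport_total:
  assumes "path C Weq x p x'" "resolution z q x" "resolution z' q' x'" "a' \<in> hom C z' y"
  shows "\<exists>a\<in>hom C z y. path_transport x p (q', a') (q, a)"
  using assms(1,2)
proof (induction p arbitrary: x z q)
  case Nil
  then have "x \<in> Obj C" "x' = x" by auto
  then show ?case using transport_total[OF ide_hom Nil(2) _ assms(4)] assms(3) by (metis path_transport.simps(1))
next
  case (Cons st p)
  show ?case
  proof (cases st)
    case (Fwd f)
    then have f: "f \<in> hom C x (Cod C f)" and p: "path C Weq (Cod C f) p x'"
      using Cons.prems by (auto simp: hom_iff)
    obtain z1 q1 where q1: "resolution z1 q1 (Cod C f)"
      using path_objs[OF p] resolution_exists by blast
    obtain b where b: "b \<in> hom C z1 y" "path_transport (Cod C f) p (q', a') (q1, b)"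
      using Cons.IH[OF p q1] by blast
    obtain a where "a \<in> hom C z y" "transport f (q1, b) (q, a)"
      using transport_total[OF f Cons.prems(2) q1 b(1)] .
    then show ?thesis using b Fwd by auto
  next
    case (Bwd w)
    then have w: "w \<in> hom C (Dom C w) x" "w \<in> Weq" and p: "path C Weq (Dom C w) p x'"
      using Cons.prems by (auto simp: hom_iff)
    obtain z1 q1 where q1: "resolution z1 q1 (Dom C w)"
      using path_objs[OF p] resolution_exists by blast
    obtain b where b: "b \<in> hom C z1 y" "path_transport (Dom C w) p (q', a') (q1, b)"
      using Cons.IH[OF p q1] by blast
    obtain a where "a \<in> hom C z y" "transport w (q, a) (q1, b)"
      using transport_weq_total[OF w q1 Cons.prems(2) b(1)] .
    then show ?thesis using b Bwd by auto
  qed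
qed

text \<open>
  An element \<open>(q, a)\<close> determines the fraction \<open>a q\<inverse>\<close> in the localization.  Transport is
  precomposition of fractions, first for one arrow and then for a path.
\<close>

lemma gz_if_transport:
  assumes e: "transport f (q', a') (q, a)" and f: "f \<in> hom C x x'"
  shows "gz_eq C Weq x y [Bwd q, Fwd a] [Fwd f, Bwd q', Fwd a']"
proof -
  obtain z z' g where *: "resolution z q x" "a \<in> hom C z y" "resolution z' q' x'" "a' \<in> hom C z' y"
      "g \<in> hom C z z'" "q' \<cdot> g = f \<cdot> q" "a \<simeq> a' \<cdot> g"
    using e f by (rule transportE) blast
  note q = resolutionD[OF *(1)] and q' = resolutionD[OF *(3)]
  have nil: "path C Weq y [] y" using path_Nil hom_objs(2)[OF *(2)] by blast
  have "gz_eq C Weq z y [Fwd a] [Fwd g, Fwd a']"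
    using gz_trans[OF gz_if_homotopic[OF *(7,2)] gz_sym[OF gz_comp_Cons[OF *(5,4) nil]]] .
  then have "gz_eq C Weq x y [Bwd q, Fwd a] [Bwd q, Fwd g, Fwd a']" by (rule gz_Bwd[OF q(2,4)])
  then show ?thesis
    using gz_square[OF q(2,4) q'(2,4) *(5) f *(6) path_Fwd[OF *(4) nil]] by (rule gz_trans)
qed

lemma gz_if_path_transport:
  assumes "path C Weq x p x'" "path_transport x p (q', a') (q, a)"
  shows "gz_eq C Weq x y [Bwd q, Fwd a] (p @ [Bwd q', Fwd a'])"
  using assms
proof (induction p arbitrary: x q a)
  case Nil
  then have x: "x \<in> Obj C" and e: "transport (Ide C x) (q', a') (q, a)" by auto
  have gz: "gz_eq C Weq x y [Bwd q, Fwd a] [Fwd (Ide C x), Bwd q', Fwd a']"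
    by (rule gz_if_transport[OF e ide_hom[OF x]])
  obtain z' where "resolution z' q' x" "a' \<in> hom C z' y"
    using e ide_hom[OF x] by (rule transportE) blast
  then have path: "path C Weq x [Bwd q', Fwd a'] y"
    using resolutionD(2,4) hom_objs(2) by (metis path_Bwd path_Fwd path_Nil)
  show ?case using gz_trans[OF gz gz_ide_Cons[OF path]] by simp
next
  case (Cons st p)
  show ?case
  proof (cases st)
    case (Fwd f)
    then have f: "f \<in> hom C x (Cod C f)" and p: "path C Weq (Cod C f) p x'"
      using Cons.prems by (auto simp: hom_iff)
    obtain q1 b where b: "path_transport (Cod C f) p (q', a') (q1, b)" "transport f (q1, b) (q, a)"
      using Cons.prems(2) Fwd by auto
    show ?thesis
      using gz_trans[OF gz_if_transport[OF b(2) f] gz_Fwd[OF f Cons.IH[OF p b(1)]]] Fwd by simp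
  next
    case (Bwd w)
    then have w: "w \<in> hom C (Dom C w) x" "w \<in> Weq" and p: "path C Weq (Dom C w) p x'"
      using Cons.prems by (auto simp: hom_iff)
    obtain q1 b where b: "path_transport (Dom C w) p (q', a') (q1, b)" "transport w (q, a) (q1, b)"
      using Cons.prems(2) Bwd by auto
    have 1: "gz_eq C Weq x y [Bwd w, Fwd w, Bwd q, Fwd a] [Bwd w, Bwd q1, Fwd b]"
      by (rule gz_Bwd[OF w gz_sym[OF gz_if_transport[OF b(2) w(1)]]])
    have 2: "gz_eq C Weq x y [Bwd w, Bwd q1, Fwd b] (Bwd w # p @ [Bwd q', Fwd a'])"
      by (rule gz_Bwd[OF w Cons.IH[OF p b(1)]])
    obtain z where "resolution z q x" "a \<in> hom C z y"
      using b(2) w(1) by (rule transportE) blast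
    then have "path C Weq x [Bwd q, Fwd a] y"
      using resolutionD(2,4) hom_objs(2) by (metis path_Bwd path_Fwd path_Nil)
    then have "gz_eq C Weq x y [Bwd q, Fwd a] [Bwd w, Fwd w, Bwd q, Fwd a]"
      by (rule gz_sym[OF gz_inv_left_Cons[OF w]])
    then show ?thesis using gz_trans[OF _ gz_trans[OF 1 2]] Bwd by simp
  qed
qed

text \<open>
  Transport of the tautological element \<open>(q', q')\<close> of \<open>y\<close>, whose fraction is the identity, along
  \<open>p\<close> yields the fraction that represents \<open>p\<close>.
\<close>

lemma path_to_fibrant_as_fraction:
  assumes p: "path C Weq x p y" and q: "resolution z q x"
  obtains a where "a \<in> hom C z y" "gz_eq C Weq x y [Bwd q, Fwd a] p"
proof -
  have y: "y \<in> Obj C" using path_objs[OF p] by blast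
  obtain z' q' where q': "resolution z' q' y" using resolution_exists[OF y] .
  obtain a where a: "a \<in> hom C z y" "path_transport x p (q', q') (q, a)"
    using path_transport_total[OF p q q' resolutionD(2)[OF q']] by blast
  have "gz_eq C Weq x y (p @ [Bwd q', Fwd q']) p"
    using gz_append_left[OF p gz_inv_left_Cons[OF resolutionD(2,4)[OF q'] path_Nil[OF y]]] by simp
  then show ?thesis using that[OF a(1)] gz_trans[OF gz_if_path_transport[OF p a(2)]] by blast
qed

lemma path_from_cofibrant_to_fibrant:
  assumes p: "path C Weq x p y" and x: "cofibrant x"
  obtains u where "u \<in> hom C x y" "gz_eq C Weq x y [Fwd u] p"
proof -
  have xo: "x \<in> Obj C" by (rule cofibrant_obj[OF x])
  have id: "resolution x (Ide C x) x" using x ide_hom[OF xo] ide_class[OF xo] by (simp add: resolution_def)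
  obtain u where u: "u \<in> hom C x y" "gz_eq C Weq x y [Bwd (Ide C x), Fwd u] p"
    using p id by (rule path_to_fibrant_as_fraction)
  have pu: "path C Weq x [Fwd u] y" using path_Fwd[OF u(1) path_Nil] hom_objs(2)[OF u(1)] by blast
  have "gz_eq C Weq x y [Fwd u] [Bwd (Ide C x), Fwd (Ide C x), Fwd u]"
    by (rule gz_sym[OF gz_inv_left_Cons[OF resolutionD(2,4)[OF id] pu]])
  moreover have "gz_eq C Weq x y [Bwd (Ide C x), Fwd (Ide C x), Fwd u] [Bwd (Ide C x), Fwd u]"
    by (rule gz_Bwd[OF resolutionD(2,4)[OF id] gz_ide_Cons[OF pu]])
  ultimately have "gz_eq C Weq x y [Fwd u] p" using u(2) by (blast intro: gz_trans)
  then show ?thesis using that u(1) by blast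
qed

text \<open>
  The Yoneda argument: restricting the tautological element of \<open>y\<close> along \<open>u\<close> gives the class of
  \<open>u\<close> itself, represented over the identity resolution of the cofibrant object \<open>x\<close>.
\<close>

lemma homotopic_if_gz:
  assumes x: "cofibrant x" and u: "u \<in> hom C x y" and v: "v \<in> hom C x y"
    and uv: "gz_eq C Weq x y [Fwd u] [Fwd v]"
  shows "u \<simeq> v"
proof -
  have xo: "x \<in> Obj C" by (rule cofibrant_obj[OF x])
  have id: "resolution x (Ide C x) x" using x ide_hom[OF xo] ide_class[OF xo] by (simp add: resolution_def)
  obtain z q where q: "resolution z q y" using resolution_exists[OF hom_objs(2)[OF u]] .
  obtain g where g: "g \<in> hom C x z" "q \<cdot> g = u"
    using cofibrantD[OF x resolutionD(2,3)[OF q] u] .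
  have "transport u (q, q) (Ide C x, u)"
    using transportI[OF u id u q resolutionD(2)[OF q] g(1)] g(2) ide_right[OF u] homotopic_refl[OF u] by simp
  then have e: "transport v (q, q) (Ide C x, u)"
    using path_transport_gz_eq[OF uv] path_transport_Fwd u v by metis
  obtain h where h: "h \<in> hom C x z" "q \<cdot> h = v"
    using cofibrantD[OF x resolutionD(2,3)[OF q] v] .
  then show ?thesis
    using transport_any_lift[OF e v h(1) ide_hom[OF xo] resolutionD(2)[OF q]] ide_right[OF v] by simp
qed

text \<open>
  The homotopies on the summands have the common target \<open>P\<close> and so form one homotopy on \<open>c\<close>.
\<close>

lemma homotopic_coproduct:
  assumes c: "is_coproduct C I Z c \<kappa>" and u: "u \<in> hom C c y" and v: "v \<in> hom C c y"
    and uv: "\<And>i. i \<in> I \<Longrightarrow> u \<cdot> \<kappa> i \<simeq> v \<cdot> \<kappa> i"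
  shows "u \<simeq> v"
proof -
  have \<kappa>: "\<kappa> i \<in> hom C (Z i) c" if "i \<in> I" for i
    using c that by (simp add: is_coproduct_def)
  have "\<exists>H. H \<in> hom C (Z i) P \<and> p0 \<cdot> H = u \<cdot> \<kappa> i \<and> p1 \<cdot> H = v \<cdot> \<kappa> i" if "i \<in> I" for i
    using homotopicE[OF uv[OF that] comp_hom[OF \<kappa>[OF that] u]] by blast
  then obtain H where H: "\<And>i. i \<in> I \<Longrightarrow> H i \<in> hom C (Z i) P \<and> p0 \<cdot> H i = u \<cdot> \<kappa> i \<and> p1 \<cdot> H i = v \<cdot> \<kappa> i"
    by metis
  obtain K where K: "K \<in> hom C c P" "\<And>i. i \<in> I \<Longrightarrow> K \<cdot> \<kappa> i = H i"
    by (rule coproduct_ex[OF c hom_objs(1)[OF p0], of H]) (use H in auto)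
  show ?thesis
  proof (rule homotopicI[OF K(1)])
    show "p0 \<cdot> K = u"
      by (rule coproduct_eqI[OF c comp_hom[OF K(1) p0] u]) (use comp_assoc[OF \<kappa> K(1) p0] K(2) H in simp)
    show "p1 \<cdot> K = v"
      by (rule coproduct_eqI[OF c comp_hom[OF K(1) p1] v]) (use comp_assoc[OF \<kappa> K(1) p1] K(2) H in simp)
  qed
qed

end


section \<open>Coproducts in the localization\<close>

lemma is_coproduct_cong:
  assumes "\<And>i. i \<in> I \<Longrightarrow> X i = Y i"
  shows "is_coproduct C I X c \<iota> \<longleftrightarrow> is_coproduct C I Y c \<iota>"
  using assms by (simp add: is_coproduct_def)

context model_category
begin

lemma path_object_locale_ex:
  assumes "fibrant y" shows "\<exists>P p0 p1 s. path_object C Cofib Fib Weq y P p0 p1 s"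
proof (rule path_object[OF assms])
  fix P p0 p1 s
  assume *: "p0 \<in> hom C P y" "p1 \<in> hom C P y" "s \<in> hom C y P"
    "p0 \<cdot> s = Ide C y" "p1 \<cdot> s = Ide C y" "p0 \<in> Fib \<inter> Weq"
    "\<And>i v w k l b. \<lbrakk>i \<in> hom C w v; i \<in> Cofib \<inter> Weq; k \<in> hom C v y; l \<in> hom C v y; b \<in> hom C w P;
      k \<cdot> i = p0 \<cdot> b; l \<cdot> i = p1 \<cdot> b\<rbrakk> \<Longrightarrow> \<exists>h\<in>hom C v P. p0 \<cdot> h = k \<and> p1 \<cdot> h = l \<and> h \<cdot> i = b"
  have "path_object C Cofib Fib Weq y P p0 p1 s"
    by (intro path_object.intro path_object_axioms.intro model_category_axioms assms *(1-6))
      (rule *(7))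
  then show ?thesis by blast
qed

context
  fixes I :: "'i set" and X :: "'i \<Rightarrow> 'o" and c :: 'o and \<iota> :: "'i \<Rightarrow> 'm"
  assumes coproducts: "has_coproducts C I" and closed: "closed_under_coproducts C I Weq"
    and c: "is_coproduct C I X c \<iota>"
begin

lemma injection_hom: "i \<in> I \<Longrightarrow> \<iota> i \<in> hom C (X i) c"
  using c by (simp add: is_coproduct_def)

text \<open>
  Resolving all \<open>X i\<close> resolves their coproduct up to a weak equivalence \<open>Q\<close>; this is where the
  closure of weak equivalences under coproducts enters.
\<close>

lemma coproduct_resolution:
  obtains Z q c' \<kappa> Q where "\<And>i. i \<in> I \<Longrightarrow> cofibrant (Z i)" "\<And>i. i \<in> I \<Longrightarrow> q i \<in> hom C (Z i) (X i)"
    "\<And>i. i \<in> I \<Longrightarrow> q i \<in> Fib \<inter> Weq" "is_coproduct C I Z c' \<kappa>" "cofibrant c'"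
    "Q \<in> hom C c' c" "Q \<in> Weq" "\<And>i. i \<in> I \<Longrightarrow> Q \<cdot> \<kappa> i = \<iota> i \<cdot> q i"
proof -
  have "\<exists>z q. cofibrant z \<and> q \<in> hom C z (X i) \<and> q \<in> Fib \<inter> Weq" if "i \<in> I" for i
    using cofibrant_replacement[OF hom_objs(1)[OF injection_hom[OF that]]] by metis
  then obtain Z q where Z: "\<And>i. i \<in> I \<Longrightarrow> cofibrant (Z i)"
    and q: "\<And>i. i \<in> I \<Longrightarrow> q i \<in> hom C (Z i) (X i)" "\<And>i. i \<in> I \<Longrightarrow> q i \<in> Fib \<inter> Weq"
    by metis
  obtain c' \<kappa> where c': "is_coproduct C I Z c' \<kappa>"
    using coproducts Z cofibrant_obj unfolding has_coproducts_def by meson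
  have \<iota>q: "\<iota> i \<cdot> q i \<in> hom C (Z i) c" if "i \<in> I" for i using q(1) injection_hom that by blast
  have "c \<in> Obj C" using c by (simp add: is_coproduct_def)
  obtain Q where Q: "Q \<in> hom C c' c" "\<And>i. i \<in> I \<Longrightarrow> Q \<cdot> \<kappa> i = \<iota> i \<cdot> q i"
    by (rule coproduct_ex[OF c' \<open>c \<in> Obj C\<close>, of "\<lambda>i. \<iota> i \<cdot> q i"]) (use \<iota>q in auto)
  have "is_coproduct C I (\<lambda>i. Dom C (q i)) c' \<kappa>" "is_coproduct C I (\<lambda>i. Cod C (q i)) c \<iota>"
    using c c' q(1) by (auto simp: hom_iff cong: is_coproduct_cong)
  then have "Q \<in> Weq"
    using closed q(2) Q unfolding closed_under_coproducts_def by blast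
  then show ?thesis using that Z q c' cofibrant_coproduct[OF c' Z] Q by blast
qed

text \<open>
  With \<open>r\<close> a fibrant replacement of \<open>d\<close>, each \<open>r \<cdot> p i\<close> is a fraction \<open>a i (q i)\<inverse>\<close>.  Let \<open>b\<close> on
  \<open>c'\<close> have the components \<open>a i\<close>; the copairing is \<open>r\<inverse> b Q\<inverse>\<close>.
\<close>

lemma paths_copair:
  assumes d: "d \<in> Obj C" and p: "\<And>i. i \<in> I \<Longrightarrow> path C Weq (X i) (p i) d"
  obtains h where "path C Weq c h d" "\<And>i. i \<in> I \<Longrightarrow> gz_eq C Weq (X i) d (Fwd (\<iota> i) # h) (p i)"
proof (rule coproduct_resolution)
  fix Z q c' \<kappa> Q
  assume Z: "\<And>i. i \<in> I \<Longrightarrow> cofibrant (Z i)" and q: "\<And>i. i \<in> I \<Longrightarrow> q i \<in> hom C (Z i) (X i)"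
    and q_tfib: "\<And>i. i \<in> I \<Longrightarrow> q i \<in> Fib \<inter> Weq" and c': "is_coproduct C I Z c' \<kappa>"
    and Q: "Q \<in> hom C c' c" "Q \<in> Weq" and Q\<kappa>: "\<And>i. i \<in> I \<Longrightarrow> Q \<cdot> \<kappa> i = \<iota> i \<cdot> q i"
  obtain y r where y: "fibrant y" and r: "r \<in> hom C d y" "r \<in> Cofib \<inter> Weq"
    using d by (rule fibrant_replacement)
  have rW: "r \<in> Weq" using r(2) by blast
  note yo = hom_objs(2)[OF r(1)]
  obtain P p0 p1 s where "path_object C Cofib Fib Weq y P p0 p1 s"
    using path_object_locale_ex[OF y] by blast
  then interpret path_object C Cofib Fib Weq y P p0 p1 s .
  have "\<exists>a. a \<in> hom C (Z i) y \<and> gz_eq C Weq (X i) y [Bwd (q i), Fwd a] (p i @ [Fwd r])" if i: "i \<in> I" for i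
  proof (rule path_to_fibrant_as_fraction)
    show "path C Weq (X i) (p i @ [Fwd r]) y"
      by (rule path_append[OF p[OF i] path_Fwd[OF r(1) path_Nil[OF yo]]])
    show "resolution (Z i) (q i) (X i)" using Z q q_tfib i by (simp add: resolution_def)
  qed blast
  then obtain a where a: "\<And>i. i \<in> I \<Longrightarrow> a i \<in> hom C (Z i) y"
    and ap: "\<And>i. i \<in> I \<Longrightarrow> gz_eq C Weq (X i) y [Bwd (q i), Fwd (a i)] (p i @ [Fwd r])" by metis
  obtain b where b: "b \<in> hom C c' y" "\<And>i. i \<in> I \<Longrightarrow> b \<cdot> \<kappa> i = a i"
    by (rule coproduct_ex[OF c' yo, of a]) (use a in auto)
  have Br: "path C Weq y [Bwd r] d" by (rule path_Bwd[OF r(1) rW path_Nil[OF d]])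
  have bBr: "path C Weq c' [Fwd b, Bwd r] d" by (rule path_Fwd[OF b(1) Br])
  have h: "path C Weq c [Bwd Q, Fwd b, Bwd r] d" by (rule path_Bwd[OF Q bBr])
  have "gz_eq C Weq (X i) d [Fwd (\<iota> i), Bwd Q, Fwd b, Bwd r] (p i)" if i: "i \<in> I" for i
  proof -
    have \<kappa>: "\<kappa> i \<in> hom C (Z i) c'" using c' i by (simp add: is_coproduct_def)
    have qW: "q i \<in> Weq" using q_tfib[OF i] by blast
    have "gz_eq C Weq (X i) d [Fwd (\<iota> i), Bwd Q, Fwd b, Bwd r] [Bwd (q i), Fwd (\<kappa> i), Fwd b, Bwd r]"
      by (rule gz_sym[OF gz_square[OF q[OF i] qW Q \<kappa> injection_hom[OF i] Q\<kappa>[OF i] bBr]])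
    moreover have "gz_eq C Weq (X i) d [Bwd (q i), Fwd (\<kappa> i), Fwd b, Bwd r] [Bwd (q i), Fwd (a i), Bwd r]"
      using gz_Bwd[OF q[OF i] qW gz_comp_Cons[OF \<kappa> b(1) Br]] b(2)[OF i] by simp
    moreover have "gz_eq C Weq (X i) d [Bwd (q i), Fwd (a i), Bwd r] (p i @ [Fwd r, Bwd r])"
      using gz_append_right[OF ap[OF i] Br] by simp
    moreover have "gz_eq C Weq (X i) d (p i @ [Fwd r, Bwd r]) (p i)"
      using gz_append_left[OF p[OF i] gz_inv_right_Cons[OF r(1) rW path_Nil[OF d]]] by simp
    ultimately show ?thesis by (blast intro: gz_trans)
  qed
  then show thesis using that h by blast
qed

text \<open>
  The arrows \<open>r h Q\<close> and \<open>r h' Q\<close> lead from a cofibrant to a fibrant object, so they come from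
  arrows \<open>u\<close> and \<open>u'\<close> of the model category.  These are homotopic on each \<open>Z i\<close>, hence homotopic,
  and \<open>r\<close> and \<open>Q\<close> cancel.
\<close>

lemma paths_copair_unique:
  assumes h: "path C Weq c h d" and h': "path C Weq c h' d"
    and eq: "\<And>i. i \<in> I \<Longrightarrow> gz_eq C Weq (X i) d (Fwd (\<iota> i) # h) (Fwd (\<iota> i) # h')"
  shows "gz_eq C Weq c d h h'"
proof (rule coproduct_resolution)
  fix Z q c' \<kappa> Q
  assume Z: "\<And>i. i \<in> I \<Longrightarrow> cofibrant (Z i)" and q: "\<And>i. i \<in> I \<Longrightarrow> q i \<in> hom C (Z i) (X i)"
    and c': "is_coproduct C I Z c' \<kappa>" "cofibrant c'"
    and Q: "Q \<in> hom C c' c" "Q \<in> Weq" and Q\<kappa>: "\<And>i. i \<in> I \<Longrightarrow> Q \<cdot> \<kappa> i = \<iota> i \<cdot> q i"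
  have d: "d \<in> Obj C" using path_objs[OF h] by blast
  obtain y r where y: "fibrant y" and r: "r \<in> hom C d y" "r \<in> Cofib \<inter> Weq"
    using d by (rule fibrant_replacement)
  have rW: "r \<in> Weq" using r(2) by blast
  note yo = hom_objs(2)[OF r(1)]
  obtain P p0 p1 s where "path_object C Cofib Fib Weq y P p0 p1 s"
    using path_object_locale_ex[OF y] by blast
  then interpret path_object C Cofib Fib Weq y P p0 p1 s .
  have Fr: "path C Weq d [Fwd r] y" by (rule path_Fwd[OF r(1) path_Nil[OF yo]])
  have Br: "path C Weq y [Bwd r] d" by (rule path_Bwd[OF r(1) rW path_Nil[OF d]])
  have \<kappa>: "\<kappa> i \<in> hom C (Z i) c'" if "i \<in> I" for i using c' that by (simp add: is_coproduct_def)
  have represent: "\<exists>u. u \<in> hom C c' y \<and> gz_eq C Weq c' y [Fwd u] (Fwd Q # k @ [Fwd r]) \<and>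
      (\<forall>i\<in>I. gz_eq C Weq (Z i) y [Fwd (u \<cdot> \<kappa> i)] (Fwd (q i) # (Fwd (\<iota> i) # k) @ [Fwd r]))"
    if k: "path C Weq c k d" for k
  proof -
    have kr: "path C Weq c (k @ [Fwd r]) y" by (rule path_append[OF k Fr])
    obtain u where u: "u \<in> hom C c' y" "gz_eq C Weq c' y [Fwd u] (Fwd Q # k @ [Fwd r])"
      using path_Fwd[OF Q(1) kr] c'(2) by (rule path_from_cofibrant_to_fibrant)
    have "gz_eq C Weq (Z i) y [Fwd (u \<cdot> \<kappa> i)] (Fwd (q i) # (Fwd (\<iota> i) # k) @ [Fwd r])" if i: "i \<in> I" for i
    proof -
      have "gz_eq C Weq (Z i) y [Fwd (u \<cdot> \<kappa> i)] [Fwd (\<kappa> i), Fwd u]"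
        by (rule gz_sym[OF gz_comp_Cons[OF \<kappa>[OF i] u(1) path_Nil[OF yo]]])
      moreover have "gz_eq C Weq (Z i) y [Fwd (\<kappa> i), Fwd u] (Fwd (\<kappa> i) # Fwd Q # k @ [Fwd r])"
        by (rule gz_Fwd[OF \<kappa>[OF i] u(2)])
      moreover have "gz_eq C Weq (Z i) y (Fwd (\<kappa> i) # Fwd Q # k @ [Fwd r]) (Fwd (\<iota> i \<cdot> q i) # k @ [Fwd r])"
        using gz_comp_Cons[OF \<kappa>[OF i] Q(1) kr] Q\<kappa>[OF i] by simp
      moreover have "gz_eq C Weq (Z i) y (Fwd (\<iota> i \<cdot> q i) # k @ [Fwd r]) (Fwd (q i) # (Fwd (\<iota> i) # k) @ [Fwd r])"
        using gz_sym[OF gz_comp_Cons[OF q[OF i] injection_hom[OF i] kr]] by simp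
      ultimately show ?thesis by (blast intro: gz_trans)
    qed
    then show ?thesis using u by blast
  qed
  obtain u where u: "u \<in> hom C c' y" "gz_eq C Weq c' y [Fwd u] (Fwd Q # h @ [Fwd r])"
      "\<And>i. i \<in> I \<Longrightarrow> gz_eq C Weq (Z i) y [Fwd (u \<cdot> \<kappa> i)] (Fwd (q i) # (Fwd (\<iota> i) # h) @ [Fwd r])"
    using represent[OF h] by blast
  obtain u' where u': "u' \<in> hom C c' y" "gz_eq C Weq c' y [Fwd u'] (Fwd Q # h' @ [Fwd r])"
      "\<And>i. i \<in> I \<Longrightarrow> gz_eq C Weq (Z i) y [Fwd (u' \<cdot> \<kappa> i)] (Fwd (q i) # (Fwd (\<iota> i) # h') @ [Fwd r])"
    using represent[OF h'] by blast
  have "homotopic u u'"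
  proof (rule homotopic_coproduct[OF c'(1) u(1) u'(1)])
    fix i assume i: "i \<in> I"
    have "gz_eq C Weq (Z i) y (Fwd (q i) # (Fwd (\<iota> i) # h) @ [Fwd r]) (Fwd (q i) # (Fwd (\<iota> i) # h') @ [Fwd r])"
      by (rule gz_Fwd[OF q[OF i] gz_append_right[OF eq[OF i] Fr]])
    then have "gz_eq C Weq (Z i) y [Fwd (u \<cdot> \<kappa> i)] [Fwd (u' \<cdot> \<kappa> i)]"
      using u(3)[OF i] u'(3)[OF i] by (blast intro: gz_trans gz_sym)
    then show "homotopic (u \<cdot> \<kappa> i) (u' \<cdot> \<kappa> i)"
      by (rule homotopic_if_gz[OF Z[OF i] comp_hom[OF \<kappa>[OF i] u(1)] comp_hom[OF \<kappa>[OF i] u'(1)]])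
  qed
  then have "gz_eq C Weq c' y [Fwd u] [Fwd u']" using u(1) by (rule gz_if_homotopic)
  then have "gz_eq C Weq c' y (Fwd Q # h @ [Fwd r]) (Fwd Q # h' @ [Fwd r])"
    using u(2) u'(2) by (blast intro: gz_trans gz_sym)
  then have "gz_eq C Weq c y (Bwd Q # Fwd Q # h @ [Fwd r]) (Bwd Q # Fwd Q # h' @ [Fwd r])"
    by (rule gz_Bwd[OF Q])
  then have "gz_eq C Weq c y (h @ [Fwd r]) (h' @ [Fwd r])"
    using gz_inv_left_Cons[OF Q path_append[OF h Fr]] gz_inv_left_Cons[OF Q path_append[OF h' Fr]]
    by (blast intro: gz_trans gz_sym)
  then have "gz_eq C Weq c d (h @ [Fwd r, Bwd r]) (h' @ [Fwd r, Bwd r])"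
    using gz_append_right[OF _ Br] by fastforce
  moreover have "gz_eq C Weq c d (k @ [Fwd r, Bwd r]) k" if "path C Weq c k d" for k
    using gz_append_left[OF that gz_inv_right_Cons[OF r(1) rW path_Nil[OF d]]] by simp
  ultimately show "gz_eq C Weq c d h h'" using h h' by (blast intro: gz_trans gz_sym)
qed

lemma is_coproduct_GZ:
  "is_coproduct (GZ C Weq) I X c (\<lambda>i. amap (GZ_functor C Weq) (\<iota> i))"
  unfolding is_coproduct_def
proof (intro conjI ballI allI impI)
  show "c \<in> Obj (GZ C Weq)" using c by (simp add: is_coproduct_def GZ_def)
  have c_obj: "c \<in> Obj C" using c by (simp add: is_coproduct_def)
  have \<iota>_path: "path C Weq (X i) [Fwd (\<iota> i)] c" if "i \<in> I" for i
    by (rule path_Fwd[OF injection_hom[OF that] path_Nil[OF c_obj]])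
  have \<iota>_class: "amap (GZ_functor C Weq) (\<iota> i) = gz_class C Weq (X i) c [Fwd (\<iota> i)]" if "i \<in> I" for i
    using injection_hom[OF that] by (simp add: GZ_functor_def hom_iff)
  show "amap (GZ_functor C Weq) (\<iota> i) \<in> hom (GZ C Weq) (X i) c" if "i \<in> I" for i
    using \<iota>_path[OF that] \<iota>_class[OF that] unfolding hom_GZ by blast
  have comp: "Comp (GZ C Weq) (gz_class C Weq c d h) (amap (GZ_functor C Weq) (\<iota> i)) =
      gz_class C Weq (X i) d (Fwd (\<iota> i) # h)" if "i \<in> I" "path C Weq c h d" for i h d
    using Comp_gz_class[OF \<iota>_path[OF that(1)] that(2)] \<iota>_class[OF that(1)] by simp
  fix d f assume "d \<in> Obj (GZ C Weq)" and f: "\<forall>i\<in>I. f i \<in> hom (GZ C Weq) (X i) d"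
  then have d: "d \<in> Obj C" by (simp add: GZ_def)
  have "\<exists>p. path C Weq (X i) p d \<and> f i = gz_class C Weq (X i) d p" if "i \<in> I" for i
    using f that unfolding hom_GZ by blast
  then obtain p where p: "\<And>i. i \<in> I \<Longrightarrow> path C Weq (X i) (p i) d"
    and fp: "\<And>i. i \<in> I \<Longrightarrow> f i = gz_class C Weq (X i) d (p i)" by metis
  have cls: "Comp (GZ C Weq) (gz_class C Weq c d h) (amap (GZ_functor C Weq) (\<iota> i)) = f i \<longleftrightarrow>
      gz_eq C Weq (X i) d (Fwd (\<iota> i) # h) (p i)" if i: "i \<in> I" and h: "path C Weq c h d" for i h
    using comp[OF i h] fp[OF i] gz_class_eq_iff[OF path_Fwd[OF injection_hom[OF i] h]] by simp
  obtain h where h: "path C Weq c h d" "\<And>i. i \<in> I \<Longrightarrow> gz_eq C Weq (X i) d (Fwd (\<iota> i) # h) (p i)"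
    by (rule paths_copair[OF d, of p]) (use p in auto)
  show "\<exists>!k. k \<in> hom (GZ C Weq) c d \<and> (\<forall>i\<in>I. Comp (GZ C Weq) k (amap (GZ_functor C Weq) (\<iota> i)) = f i)"
  proof (rule ex1I[of _ "gz_class C Weq c d h"])
    show "gz_class C Weq c d h \<in> hom (GZ C Weq) c d \<and>
        (\<forall>i\<in>I. Comp (GZ C Weq) (gz_class C Weq c d h) (amap (GZ_functor C Weq) (\<iota> i)) = f i)"
      using h cls unfolding hom_GZ by blast
    fix k assume k: "k \<in> hom (GZ C Weq) c d \<and>
        (\<forall>i\<in>I. Comp (GZ C Weq) k (amap (GZ_functor C Weq) (\<iota> i)) = f i)"
    then obtain h' where h': "path C Weq c h' d" "k = gz_class C Weq c d h'" unfolding hom_GZ by blast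
    have "gz_eq C Weq c d h' h"
      using k h'(2) cls[OF _ h'(1)] h(2) by (intro paths_copair_unique[OF h'(1) h(1)]) (blast intro: gz_trans gz_sym)
    then show "k = gz_class C Weq c d h" using gz_class_eq_iff[OF h'(1)] h'(2) by blast
  qed
qed

end

theorem GZ_functor_preserves_coproducts:
  assumes "has_coproducts C I" "closed_under_coproducts C I Weq"
  shows "preserves_coproducts C (GZ C Weq) (GZ_functor C Weq) I"
  using is_coproduct_GZ[OF assms] by (simp add: preserves_coproducts_def GZ_functor_def)

end


section \<open>The localization of the opposite category\<close>

lemma path_op_cat:
  assumes "category C" "path C W x p y" shows "path (op_cat C) W y (rev p) x"
  using assms(2)
proof (induction p arbitrary: x)
  case Nil
  then show ?case by auto
next
  case (Cons st p)
  interpret op: category "op_cat C" by (rule category_op_cat) fact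
  show ?case
  proof (cases st)
    case (Fwd f)
    then have "path (op_cat C) W y (rev p) (Cod C f)" "path (op_cat C) W (Cod C f) [Fwd f] x"
      using Cons category.dom_obj[OF assms(1)] by auto
    then show ?thesis using Fwd by (auto intro: op.path_append)
  next
    case (Bwd w)
    then have "path (op_cat C) W y (rev p) (Dom C w)" "path (op_cat C) W (Dom C w) [Bwd w] x"
      using Cons category.cod_obj[OF assms(1)] by auto
    then show ?thesis using Bwd by (auto intro: op.path_append)
  qed
qed

lemma gz_eq_op_cat:
  assumes "category C" "gz_eq C W x y p q" shows "gz_eq (op_cat C) W y x (rev p) (rev q)"
  using assms(2)
proof (induction rule: gz_eq.induct)
  case (gz_refl x p y)
  then show ?case using path_op_cat[OF assms(1)] by (blast intro: gz_eq.gz_refl)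
next
  case (gz_sym x y p q)
  show ?case by (rule gz_eq.gz_sym[OF gz_sym.IH])
next
  case (gz_trans x y p q r)
  show ?case by (rule gz_eq.gz_trans[OF gz_trans.IH])
next
  case (gz_append x y p q z p' q')
  then show ?case by (auto intro: gz_eq.gz_append)
next
  case (gz_ide x)
  then show ?case using gz_eq.gz_ide[of x "op_cat C" W] by simp
next
  case (gz_comp f x y g z)
  then show ?case using gz_eq.gz_comp[of g "op_cat C" z y f x W] by simp
next
  case (gz_inv_right w x y)
  then show ?case using gz_eq.gz_inv_left[of w W "op_cat C" y x] by simp
next
  case (gz_inv_left w x y)
  then show ?case using gz_eq.gz_inv_right[of w W "op_cat C" y x] by simp
qed

definition flip_gz :: "('o, 'm) gz_arr \<Rightarrow> ('o, 'm) gz_arr" where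
  "flip_gz = (\<lambda>(x, y, P). (y, x, rev ` P))"

lemma flip_gz_flip_gz [simp]: "flip_gz (flip_gz a) = a"
  by (cases a) (simp add: flip_gz_def image_image)

lemma flip_gz_class:
  assumes "category C" shows "flip_gz (gz_class C W x y p) = gz_class (op_cat C) W y x (rev p)"
proof -
  have "rev ` {q. gz_eq C W x y p q} = {q. gz_eq (op_cat C) W y x (rev p) q}"
  proof (intro equalityI subsetI)
    fix q assume "q \<in> {q. gz_eq (op_cat C) W y x (rev p) q}"
    then have "gz_eq C W x y p (rev q)"
      using gz_eq_op_cat[OF category_op_cat[OF assms], of W y x "rev p" q] by simp
    then show "q \<in> rev ` {q. gz_eq C W x y p q}" by (intro image_eqI[of _ _ "rev q"]) auto
  qed (use gz_eq_op_cat[OF assms] in auto)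
  then show ?thesis by (simp add: flip_gz_def gz_class_def)
qed

lemma flip_gz_hom:
  assumes "category C" "a \<in> hom (GZ C W) x y" shows "flip_gz a \<in> hom (GZ (op_cat C) W) y x"
proof -
  obtain p where "a = gz_class C W x y p" "path C W x p y"
    using assms by (auto simp: category.hom_GZ)
  then show ?thesis
    using flip_gz_class[OF assms(1)] path_op_cat[OF assms(1)]
    by (auto simp: category.hom_GZ[OF category_op_cat[OF assms(1)]])
qed

lemma flip_gz_comp:
  assumes C: "category C" and a: "a \<in> hom (GZ C W) x y" and b: "b \<in> hom (GZ C W) y z"
  shows "flip_gz (Comp (GZ C W) b a) = Comp (GZ (op_cat C) W) (flip_gz a) (flip_gz b)"
proof -
  obtain p q where p: "a = gz_class C W x y p" "path C W x p y"
    and q: "b = gz_class C W y z q" "path C W y q z"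
    using a b by (auto simp: category.hom_GZ[OF C])
  show ?thesis
    using category.Comp_gz_class[OF C p(2) q(2)] flip_gz_class[OF C] p q
      category.Comp_gz_class[OF category_op_cat[OF C] path_op_cat[OF C q(2)] path_op_cat[OF C p(2)]]
    by simp
qed

text \<open>
  \<open>flip_gz\<close> is an isomorphism from the localization of the opposite category to the opposite of the
  localization.
\<close>

lemma is_product_GZ_if_op:
  assumes C: "category C" and co: "is_coproduct (GZ (op_cat C) W) I X c \<iota>"
  shows "is_product (GZ C W) I X c (\<lambda>i. flip_gz (\<iota> i))"
proof -
  have Cop: "category (op_cat C)" by (rule category_op_cat[OF C])
  have to_op: "flip_gz a \<in> hom (GZ (op_cat C) W) v u" if "a \<in> hom (GZ C W) u v" for a u v
    by (rule flip_gz_hom[OF C that])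
  have from_op: "flip_gz a \<in> hom (GZ C W) v u" if "a \<in> hom (GZ (op_cat C) W) u v" for a u v
    using flip_gz_hom[OF Cop that] by simp
  have \<iota>: "\<iota> i \<in> hom (GZ (op_cat C) W) (X i) c" if "i \<in> I" for i
    using co that by (simp add: is_coproduct_def)
  have comp_eq: "Comp (GZ C W) (flip_gz (\<iota> i)) (flip_gz h) = flip_gz (Comp (GZ (op_cat C) W) h (\<iota> i))"
    if "i \<in> I" "h \<in> hom (GZ (op_cat C) W) c d" for i h d
    using flip_gz_comp[OF Cop \<iota>[OF that(1)] that(2)] by simp
  show ?thesis
    unfolding is_product_def
  proof (intro conjI ballI allI impI)
    show "c \<in> Obj (GZ C W)" using co by (simp add: is_coproduct_def GZ_def)
    show "flip_gz (\<iota> i) \<in> hom (GZ C W) c (X i)" if "i \<in> I" for i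
      using from_op \<iota> that by blast
    fix d f assume d: "d \<in> Obj (GZ C W)" and f: "\<forall>i\<in>I. f i \<in> hom (GZ C W) d (X i)"
    have "\<exists>!h. h \<in> hom (GZ (op_cat C) W) c d \<and> (\<forall>i\<in>I. Comp (GZ (op_cat C) W) h (\<iota> i) = flip_gz (f i))"
      using co d f to_op by (simp add: is_coproduct_def GZ_def)
    then obtain h where h: "h \<in> hom (GZ (op_cat C) W) c d"
        "\<forall>i\<in>I. Comp (GZ (op_cat C) W) h (\<iota> i) = flip_gz (f i)"
      and unique: "\<And>k. k \<in> hom (GZ (op_cat C) W) c d \<Longrightarrow>
        \<forall>i\<in>I. Comp (GZ (op_cat C) W) k (\<iota> i) = flip_gz (f i) \<Longrightarrow> k = h" by blast
    show "\<exists>!h. h \<in> hom (GZ C W) d c \<and> (\<forall>i\<in>I. Comp (GZ C W) (flip_gz (\<iota> i)) h = f i)"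
    proof (rule ex1I[of _ "flip_gz h"])
      show "flip_gz h \<in> hom (GZ C W) d c \<and> (\<forall>i\<in>I. Comp (GZ C W) (flip_gz (\<iota> i)) (flip_gz h) = f i)"
        using h from_op comp_eq by simp
      fix k assume k: "k \<in> hom (GZ C W) d c \<and> (\<forall>i\<in>I. Comp (GZ C W) (flip_gz (\<iota> i)) k = f i)"
      then have "flip_gz k = h"
        using comp_eq[OF _ to_op] by (intro unique to_op) (simp, metis flip_gz_flip_gz)
      then show "k = flip_gz h" by auto
    qed
  qed
qed

lemma (in model_category) GZ_functor_preserves_products:
  assumes "has_products C I" "closed_under_products C I Weq"
  shows "preserves_products C (GZ C Weq) (GZ_functor C Weq) I"
proof -
  interpret op: model_category "op_cat C" Fib Cofib Weq by (rule model_category_op_cat)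
  have pres: "preserves_coproducts (op_cat C) (GZ (op_cat C) Weq) (GZ_functor (op_cat C) Weq) I"
    using assms by (intro op.GZ_functor_preserves_coproducts)
      (simp_all add: has_coproducts_op_cat closed_under_coproducts_op_cat)
  have flip: "flip_gz (amap (GZ_functor (op_cat C) Weq) f) = amap (GZ_functor C Weq) f" for f
    using flip_gz_class[OF op.category_axioms] by (simp add: GZ_functor_def)
  show ?thesis
    unfolding preserves_products_def
  proof (intro allI impI)
    fix X c \<pi> assume "(\<forall>i\<in>I. X i \<in> Obj C) \<and> is_product C I X c \<pi>"
    then have "is_coproduct (GZ (op_cat C) Weq) I X c (\<lambda>i. amap (GZ_functor (op_cat C) Weq) (\<pi> i))"
      using pres unfolding preserves_coproducts_def by (simp add: is_coproduct_op_cat GZ_functor_def)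
    then have "is_product (GZ C Weq) I X c (\<lambda>i. amap (GZ_functor C Weq) (\<pi> i))"
      using is_product_GZ_if_op[OF category_axioms, of Weq I X c] flip by fastforce
    then show "is_product (GZ C Weq) I (\<lambda>i. omap (GZ_functor C Weq) (X i)) (omap (GZ_functor C Weq) c)
        (\<lambda>i. amap (GZ_functor C Weq) (\<pi> i))"
      by (simp add: GZ_functor_def)
  qed
qed

lemma has_coproducts_GZ:
  assumes "has_coproducts C I" "preserves_coproducts C (GZ C W) (GZ_functor C W) I"
  shows "has_coproducts (GZ C W) I"
  using assms unfolding has_coproducts_def preserves_coproducts_def
  by (simp add: GZ_def GZ_functor_def) blast

lemma has_products_GZ:
  assumes "has_products C I" "preserves_products C (GZ C W) (GZ_functor C W) I"
  shows "has_products (GZ C W) I"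
  using assms unfolding has_products_def preserves_products_def
  by (simp add: GZ_def GZ_functor_def) blast

theorem corollary6p9:
  fixes \<A> :: "('o, 'm) cat"
    and Cofib Fib Weq :: "'m set"
    and I :: "'i set"
    and \<U> :: "'i set set"
  assumes "has_finite_products \<A>"
    and "has_finite_coproducts \<A>"
    and "model_structure \<A> Cofib Fib Weq"
  shows "(has_coproducts \<A> I \<and> closed_under_coproducts \<A> I Weq \<longrightarrow>
            has_coproducts (GZ \<A> Weq) I \<and>
            preserves_coproducts \<A> (GZ \<A> Weq) (GZ_functor \<A> Weq) I)
       \<and> (has_products \<A> I \<and> closed_under_products \<A> I Weq \<longrightarrow>
            has_products (GZ \<A> Weq) I \<and>
            preserves_products \<A> (GZ \<A> Weq) (GZ_functor \<A> Weq) I)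
       \<and> ((\<forall>J\<in>\<U>. has_coproducts \<A> J \<and> closed_under_coproducts \<A> J Weq) \<longrightarrow>
            (\<forall>J\<in>\<U>. preserves_coproducts \<A> (GZ \<A> Weq) (GZ_functor \<A> Weq) J))
       \<and> ((\<forall>J\<in>\<U>. has_products \<A> J \<and> closed_under_products \<A> J Weq) \<longrightarrow>
            (\<forall>J\<in>\<U>. preserves_products \<A> (GZ \<A> Weq) (GZ_functor \<A> Weq) J))"
proof -
  interpret model_category \<A> Cofib Fib Weq
    using assms by (intro model_category.intro model_category_axioms.intro)
  show ?thesis
    using GZ_functor_preserves_coproducts GZ_functor_preserves_products
      has_coproducts_GZ has_products_GZ by blast
qed

end
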